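(* There exists a Hermitian bicontact manifold of bidegree $(1,1)$, i.e. a manifold $M$ with a normal metric contact pair $(\alpha_1,\alpha_2,\phi,g)$ with decomposable $\phi$, carrying a closed (compact without boundary) complex submanifold $N$ (i.e. $N$ is invariant with respect to the complex structure $J=\phi-\alpha_2\otimes Z_1+\alpha_1\otimes Z_2$, where $Z_1,Z_2$ are the Reeb vector fields) which does not inherit a bicontact structure, that is, the pair of 1-forms induced on $N$ by $(\alpha_1,\alpha_2)$ is not a contact pair (of any type) on $N$.
   Context: All objects are smooth. Convention: $d\alpha(X,Y)=\frac12[X\alpha(Y)-Y\alpha(X)-\alpha([X,Y])]$. Contact pair (also called bicontact structure): a contact pair of type $(h,k)$ ($h,k\ge 0$ integers) on a manifold $M$ is a pair $(\alpha_1,\alpha_2)$ of 1-forms such that $\alpha_1\wedge(d\alpha_1)^h\wedge\alpha_2\wedge(d\alpha_2)^k$ is a volume form, $(d\alpha_1)^{h+1}=0$ and $(d\alpha_2)^{k+1}=0$ (so $\dim M=2h+2k+2$). Its Reeb vector fields $Z_1,Z_2$ are the unique vector fields with $\alpha_i(Z_j)=\delta_{ij}$ and $i_{Z_i}d\alpha_j=0$ for $i,j=1,2$. The distribution $\ker\alpha_i\cap\ker d\alpha_i$ is integrable and defines the characteristic foliation $\mathcal{F}_i$ of $\alpha_i$, and $TM=T\mathcal{F}_1\oplus T\mathcal{F}_2$. Metric contact pair (MCP): a 4-tuple $(\alpha_1,\alpha_2,\phi,g)$ where $(\alpha_1,\alpha_2)$ is a contact pair on $M$ with Reeb vector fields $Z_1,Z_2$,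 $\phi$ is an endomorphism field of $TM$ with $\phi^2=-\mathrm{Id}+\alpha_1\otimes Z_1+\alpha_2\otimes Z_2$ and $\phi Z_1=\phi Z_2=0$, and $g$ is a Riemannian metric with $g(X,\phi Y)=(d\alpha_1+d\alpha_2)(X,Y)$ and $g(X,Z_i)=\alpha_i(X)$, $i=1,2$. $\phi$ is decomposable if $\phi(T\mathcal{F}_i)\subset T\mathcal{F}_i$ for $i=1,2$. The MCP is normal if the two almost complex structures $J=\phi-\alpha_2\otimes Z_1+\alpha_1\otimes Z_2$ and $T=\phi+\alpha_2\otimes Z_1-\alpha_1\otimes Z_2$ are both integrable. Hermitian bicontact manifolds of bidegree $(1,1)$ are exactly the normal MCP manifolds with decomposable $\phi$ (here "bidegree $(1,1)$" is not the type $(h,k)$). *)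

theory Defs
  imports "HOL-Analysis.Analysis" "HOL-Combinatorics.Permutations"
begin

section \<open>Smooth maps and smooth manifolds\<close>

text \<open>Class $C^k$ on an open set, via iterated directional derivatives.\<close>

primrec Ck_on :: "nat \<Rightarrow> 'a::euclidean_space set \<Rightarrow> ('a \<Rightarrow> 'b::euclidean_space) \<Rightarrow> bool" where
  "Ck_on 0 S f \<longleftrightarrow> continuous_on S f"
| "Ck_on (Suc k) S f \<longleftrightarrow>
     (\<forall>x\<in>S. f differentiable (at x)) \<and> (\<forall>v. Ck_on k S (\<lambda>x. frechet_derivative f (at x) v))"

text \<open>A map on an arbitrary subset of a Euclidean space is smooth if it extends, locally near
  each point, to a smooth map on an open set.\<close>

definition smooth_on :: "'a::euclidean_space set \<Rightarrow> ('a \<Rightarrow> 'b::euclidean_space) \<Rightarrow> bool" where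
  "smooth_on S f \<longleftrightarrow>
     (\<forall>x\<in>S. \<exists>W g. open W \<and> x \<in> W \<and> (\<forall>k. Ck_on k W g) \<and> (\<forall>y\<in>S \<inter> W. g y = f y))"

definition diffeo :: "'a::euclidean_space set \<Rightarrow> 'b::euclidean_space set \<Rightarrow> ('a \<Rightarrow> 'b) \<Rightarrow> bool" where
  "diffeo A B f \<longleftrightarrow>
     (\<exists>g. smooth_on A f \<and> smooth_on B g \<and> f ` A = B \<and> g ` B = A \<and>
          (\<forall>x\<in>A. g (f x) = x) \<and> (\<forall>y\<in>B. f (g y) = y))"

text \<open>Smooth manifolds without boundary are realised as embedded submanifolds of a Euclidean
  space (no loss of generality, by Whitney's theorem). To keep the dimension \<open>d\<close> a number rather
  than a type, the role of $\mathbb{R}^d$ is played by a \<open>d\<close>-dimensional linear subspace \<open>V\<close> of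
  the ambient space. If \<open>N \<subseteq> M\<close> are both manifolds in this sense, then \<open>N\<close> is an embedded
  submanifold of \<open>M\<close>.\<close>

definition manifold :: "nat \<Rightarrow> 'a::euclidean_space set \<Rightarrow> bool" where
  "manifold d M \<longleftrightarrow>
     (\<forall>p\<in>M. \<exists>W V U \<zeta>. open W \<and> p \<in> W \<and> subspace V \<and> dim V = d \<and>
        openin (top_of_set V) U \<and> diffeo (M \<inter> W) (U :: 'a set) \<zeta>)"

definition tangent_space :: "'a::euclidean_space set \<Rightarrow> 'a \<Rightarrow> 'a set" where
  "tangent_space M p =
     {v. \<exists>\<gamma> \<epsilon>. \<epsilon> > (0::real) \<and> smooth_on {-\<epsilon><..<\<epsilon>} \<gamma> \<and> \<gamma> ` {-\<epsilon><..<\<epsilon>} \<subseteq> M \<and> \<gamma> 0 = p \<and>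
         (\<gamma> has_vector_derivative v) (at 0)}"

text \<open>The differential at \<open>p\<close> of a map that is smooth on \<open>M\<close>. Derivatives within \<open>M\<close> need not be
  unique as linear maps of the ambient space, but they all agree on \<open>tangent_space M p\<close>; the
  differential is only ever applied to tangent vectors.\<close>

definition differential ::
  "'a::euclidean_space set \<Rightarrow> ('a \<Rightarrow> 'b::euclidean_space) \<Rightarrow> 'a \<Rightarrow> 'a \<Rightarrow> 'b" where
  "differential M f p = frechet_derivative f (at p within M)"

section \<open>Tensor fields\<close>

text \<open>Tensor fields are functions of a point and of ambient vectors. Only the values on tangent
  vectors of \<open>M\<close> at points of \<open>M\<close> are meaningful, and all conditions below refer to these values
  only. In particular the form induced on a submanifold \<open>N\<close> by a form on \<open>M\<close> (its pullback under
  the inclusion) is given by the same function, now regarded as a form on \<open>N\<close>.\<close>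

definition linear_on_subspace :: "'a::real_vector set \<Rightarrow> ('a \<Rightarrow> 'b::real_vector) \<Rightarrow> bool" where
  "linear_on_subspace T f \<longleftrightarrow>
     (\<forall>u\<in>T. \<forall>v\<in>T. \<forall>a b. f (a *\<^sub>R u + b *\<^sub>R v) = a *\<^sub>R f u + b *\<^sub>R f v)"

definition vector_field :: "'a::euclidean_space set \<Rightarrow> ('a \<Rightarrow> 'a) \<Rightarrow> bool" where
  "vector_field M X \<longleftrightarrow> smooth_on M X \<and> (\<forall>p\<in>M. X p \<in> tangent_space M p)"

definition lie_bracket ::
  "'a::euclidean_space set \<Rightarrow> ('a \<Rightarrow> 'a) \<Rightarrow> ('a \<Rightarrow> 'a) \<Rightarrow> 'a \<Rightarrow> 'a" where
  "lie_bracket M X Y p = differential M Y p (X p) - differential M X p (Y p)"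

definition one_form :: "'a::euclidean_space set \<Rightarrow> ('a \<Rightarrow> 'a \<Rightarrow> real) \<Rightarrow> bool" where
  "one_form M \<alpha> \<longleftrightarrow>
     (\<forall>p\<in>M. linear_on_subspace (tangent_space M p) (\<alpha> p)) \<and>
     (\<forall>X. vector_field M X \<longrightarrow> smooth_on M (\<lambda>p. \<alpha> p (X p)))"

definition endomorphism_field :: "'a::euclidean_space set \<Rightarrow> ('a \<Rightarrow> 'a \<Rightarrow> 'a) \<Rightarrow> bool" where
  "endomorphism_field M \<phi> \<longleftrightarrow>
     (\<forall>p\<in>M. linear_on_subspace (tangent_space M p) (\<phi> p) \<and>
            \<phi> p ` tangent_space M p \<subseteq> tangent_space M p) \<and>
     (\<forall>X. vector_field M X \<longrightarrow> smooth_on M (\<lambda>p. \<phi> p (X p)))"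

definition riemannian_metric :: "'a::euclidean_space set \<Rightarrow> ('a \<Rightarrow> 'a \<Rightarrow> 'a \<Rightarrow> real) \<Rightarrow> bool" where
  "riemannian_metric M g \<longleftrightarrow>
     (\<forall>p\<in>M. \<forall>u\<in>tangent_space M p.
        linear_on_subspace (tangent_space M p) (g p u) \<and>
        (\<forall>v\<in>tangent_space M p. g p u v = g p v u) \<and>
        (u \<noteq> 0 \<longrightarrow> g p u u > 0)) \<and>
     (\<forall>X Y. vector_field M X \<and> vector_field M Y \<longrightarrow> smooth_on M (\<lambda>p. g p (X p) (Y p)))"

text \<open>$d\alpha(X,Y) = \frac12 [X\alpha(Y) - Y\alpha(X) - \alpha([X,Y])]$, evaluated on tangent
  vectors \<open>u, v\<close> at \<open>p\<close> through arbitrary vector fields extending them.\<close>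

definition ext_deriv ::
  "'a::euclidean_space set \<Rightarrow> ('a \<Rightarrow> 'a \<Rightarrow> real) \<Rightarrow> 'a \<Rightarrow> 'a \<Rightarrow> 'a \<Rightarrow> real" where
  "ext_deriv M \<alpha> p u v =
     (THE r. \<exists>X Y. vector_field M X \<and> vector_field M Y \<and> X p = u \<and> Y p = v \<and>
        r = 1/2 * (differential M (\<lambda>q. \<alpha> q (Y q)) p (X p)
                   - differential M (\<lambda>q. \<alpha> q (X q)) p (Y p)
                   - \<alpha> p (lie_bracket M X Y p)))"

text \<open>A \<open>k\<close>-form at a point is a function of the vectors \<open>v 0, \<dots>, v (k - 1)\<close>. The factor
  $1/(k+l)!$ in the wedge product is the normalisation matching the factor $1/2$ in \<open>ext_deriv\<close>.\<close>

definition wedge ::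
  "nat \<Rightarrow> nat \<Rightarrow> ((nat \<Rightarrow> 'a) \<Rightarrow> real) \<Rightarrow> ((nat \<Rightarrow> 'a) \<Rightarrow> real) \<Rightarrow> (nat \<Rightarrow> 'a) \<Rightarrow> real" where
  "wedge k l \<omega> \<eta> v =
     (\<Sum>\<sigma> | \<sigma> permutes {..<k + l}.
        of_int (sign \<sigma>) * \<omega> (\<lambda>i. v (\<sigma> i)) * \<eta> (\<lambda>i. v (\<sigma> (k + i)))) / fact (k + l)"

primrec wedge_power :: "nat \<Rightarrow> ((nat \<Rightarrow> 'a) \<Rightarrow> real) \<Rightarrow> nat \<Rightarrow> (nat \<Rightarrow> 'a) \<Rightarrow> real" where
  "wedge_power k \<omega> 0 = (\<lambda>v. 1)"
| "wedge_power k \<omega> (Suc n) = wedge k (k * n) \<omega> (wedge_power k \<omega> n)"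

definition as_1form :: "('a \<Rightarrow> real) \<Rightarrow> (nat \<Rightarrow> 'a) \<Rightarrow> real" where
  "as_1form \<alpha> v = \<alpha> (v 0)"

definition as_2form :: "('a \<Rightarrow> 'a \<Rightarrow> real) \<Rightarrow> (nat \<Rightarrow> 'a) \<Rightarrow> real" where
  "as_2form \<omega> v = \<omega> (v 0) (v 1)"

section \<open>Contact pairs\<close>

definition contact_pair ::
  "nat \<Rightarrow> 'a::euclidean_space set \<Rightarrow> nat \<Rightarrow> nat \<Rightarrow> ('a \<Rightarrow> 'a \<Rightarrow> real) \<Rightarrow> ('a \<Rightarrow> 'a \<Rightarrow> real) \<Rightarrow> bool" where
  "contact_pair d M h k \<alpha>1 \<alpha>2 \<longleftrightarrow>
     manifold d M \<and> d = 2 * h + 2 * k + 2 \<and> one_form M \<alpha>1 \<and> one_form M \<alpha>2 \<and>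
     (\<forall>p\<in>M.
        (\<exists>v. (\<forall>i<d. v i \<in> tangent_space M p) \<and>
           wedge 1 (2 * h + (1 + 2 * k)) (as_1form (\<alpha>1 p))
             (wedge (2 * h) (1 + 2 * k) (wedge_power 2 (as_2form (ext_deriv M \<alpha>1 p)) h)
               (wedge 1 (2 * k) (as_1form (\<alpha>2 p))
                 (wedge_power 2 (as_2form (ext_deriv M \<alpha>2 p)) k))) v \<noteq> 0) \<and>
        (\<forall>v. (\<forall>i<2 * (h + 1). v i \<in> tangent_space M p) \<longrightarrow>
           wedge_power 2 (as_2form (ext_deriv M \<alpha>1 p)) (h + 1) v = 0) \<and>
        (\<forall>v. (\<forall>i<2 * (k + 1). v i \<in> tangent_space M p) \<longrightarrow>
           wedge_power 2 (as_2form (ext_deriv M \<alpha>2 p)) (k + 1) v = 0))"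

definition reeb_fields ::
  "'a::euclidean_space set \<Rightarrow> ('a \<Rightarrow> 'a \<Rightarrow> real) \<Rightarrow> ('a \<Rightarrow> 'a \<Rightarrow> real) \<Rightarrow> ('a \<Rightarrow> 'a) \<Rightarrow> ('a \<Rightarrow> 'a) \<Rightarrow> bool" where
  "reeb_fields M \<alpha>1 \<alpha>2 Z1 Z2 \<longleftrightarrow>
     vector_field M Z1 \<and> vector_field M Z2 \<and>
     (\<forall>p\<in>M. \<alpha>1 p (Z1 p) = 1 \<and> \<alpha>1 p (Z2 p) = 0 \<and> \<alpha>2 p (Z1 p) = 0 \<and> \<alpha>2 p (Z2 p) = 1 \<and>
        (\<forall>v\<in>tangent_space M p.
           ext_deriv M \<alpha>1 p (Z1 p) v = 0 \<and> ext_deriv M \<alpha>1 p (Z2 p) v = 0 \<and>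
           ext_deriv M \<alpha>2 p (Z1 p) v = 0 \<and> ext_deriv M \<alpha>2 p (Z2 p) v = 0))"

text \<open>The tangent space at \<open>p\<close> of the characteristic foliation of \<open>\<alpha>\<close>.\<close>

definition char_space :: "'a::euclidean_space set \<Rightarrow> ('a \<Rightarrow> 'a \<Rightarrow> real) \<Rightarrow> 'a \<Rightarrow> 'a set" where
  "char_space M \<alpha> p =
     {v \<in> tangent_space M p. \<alpha> p v = 0 \<and> (\<forall>w\<in>tangent_space M p. ext_deriv M \<alpha> p v w = 0)}"

definition metric_contact_pair ::
  "nat \<Rightarrow> 'a::euclidean_space set \<Rightarrow> nat \<Rightarrow> nat \<Rightarrow> ('a \<Rightarrow> 'a \<Rightarrow> real) \<Rightarrow> ('a \<Rightarrow> 'a \<Rightarrow> real) \<Rightarrow>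
   ('a \<Rightarrow> 'a) \<Rightarrow> ('a \<Rightarrow> 'a) \<Rightarrow> ('a \<Rightarrow> 'a \<Rightarrow> 'a) \<Rightarrow> ('a \<Rightarrow> 'a \<Rightarrow> 'a \<Rightarrow> real) \<Rightarrow> bool" where
  "metric_contact_pair d M h k \<alpha>1 \<alpha>2 Z1 Z2 \<phi> g \<longleftrightarrow>
     contact_pair d M h k \<alpha>1 \<alpha>2 \<and> reeb_fields M \<alpha>1 \<alpha>2 Z1 Z2 \<and>
     endomorphism_field M \<phi> \<and> riemannian_metric M g \<and>
     (\<forall>p\<in>M.
        \<phi> p (Z1 p) = 0 \<and> \<phi> p (Z2 p) = 0 \<and>
        (\<forall>u\<in>tangent_space M p.
           \<phi> p (\<phi> p u) = - u + \<alpha>1 p u *\<^sub>R Z1 p + \<alpha>2 p u *\<^sub>R Z2 p \<and>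
           g p u (Z1 p) = \<alpha>1 p u \<and> g p u (Z2 p) = \<alpha>2 p u \<and>
           (\<forall>v\<in>tangent_space M p.
              g p u (\<phi> p v) = ext_deriv M \<alpha>1 p u v + ext_deriv M \<alpha>2 p u v)))"

definition decomposable ::
  "'a::euclidean_space set \<Rightarrow> ('a \<Rightarrow> 'a \<Rightarrow> real) \<Rightarrow> ('a \<Rightarrow> 'a \<Rightarrow> real) \<Rightarrow> ('a \<Rightarrow> 'a \<Rightarrow> 'a) \<Rightarrow> bool" where
  "decomposable M \<alpha>1 \<alpha>2 \<phi> \<longleftrightarrow>
     (\<forall>p\<in>M. \<phi> p ` char_space M \<alpha>1 p \<subseteq> char_space M \<alpha>1 p \<and>
            \<phi> p ` char_space M \<alpha>2 p \<subseteq> char_space M \<alpha>2 p)"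

definition J_structure ::
  "('a \<Rightarrow> 'a \<Rightarrow> real) \<Rightarrow> ('a \<Rightarrow> 'a \<Rightarrow> real) \<Rightarrow> ('a \<Rightarrow> 'a) \<Rightarrow> ('a \<Rightarrow> 'a) \<Rightarrow> ('a \<Rightarrow> 'a \<Rightarrow> 'a::real_vector) \<Rightarrow>
   'a \<Rightarrow> 'a \<Rightarrow> 'a" where
  "J_structure \<alpha>1 \<alpha>2 Z1 Z2 \<phi> p v = \<phi> p v - \<alpha>2 p v *\<^sub>R Z1 p + \<alpha>1 p v *\<^sub>R Z2 p"

definition T_structure ::
  "('a \<Rightarrow> 'a \<Rightarrow> real) \<Rightarrow> ('a \<Rightarrow> 'a \<Rightarrow> real) \<Rightarrow> ('a \<Rightarrow> 'a) \<Rightarrow> ('a \<Rightarrow> 'a) \<Rightarrow> ('a \<Rightarrow> 'a \<Rightarrow> 'a::real_vector) \<Rightarrow>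
   'a \<Rightarrow> 'a \<Rightarrow> 'a" where
  "T_structure \<alpha>1 \<alpha>2 Z1 Z2 \<phi> p v = \<phi> p v + \<alpha>2 p v *\<^sub>R Z1 p - \<alpha>1 p v *\<^sub>R Z2 p"

definition almost_complex :: "'a::euclidean_space set \<Rightarrow> ('a \<Rightarrow> 'a \<Rightarrow> 'a) \<Rightarrow> bool" where
  "almost_complex M J \<longleftrightarrow>
     endomorphism_field M J \<and> (\<forall>p\<in>M. \<forall>v\<in>tangent_space M p. J p (J p v) = - v)"

text \<open>An almost complex structure is integrable if it is induced by holomorphic coordinates:
  around every point there is a chart \<open>\<zeta>\<close> onto an open subset of a complex vector space whose
  differential is complex linear. The complex vector space is a real subspace \<open>V\<close> of the ambient
  space together with a linear \<open>I\<close> on \<open>V\<close> (multiplication by $\mathrm{i}$) with \<open>I\<^sup>2 = -1\<close>.\<close>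

definition integrable_acs :: "nat \<Rightarrow> 'a::euclidean_space set \<Rightarrow> ('a \<Rightarrow> 'a \<Rightarrow> 'a) \<Rightarrow> bool" where
  "integrable_acs d M J \<longleftrightarrow>
     almost_complex M J \<and>
     (\<forall>p\<in>M. \<exists>W V U I \<zeta>. open W \<and> p \<in> W \<and> subspace V \<and> dim V = d \<and>
        linear_on_subspace V I \<and> I ` V \<subseteq> V \<and> (\<forall>x\<in>V. I (I x) = - x) \<and>
        openin (top_of_set V) U \<and> diffeo (M \<inter> W) (U :: 'a set) \<zeta> \<and>
        (\<forall>q\<in>M \<inter> W. \<forall>v\<in>tangent_space M q.
           differential M \<zeta> q (J q v) = I (differential M \<zeta> q v)))"

text \<open>Hermitian bicontact manifolds of bidegree $(1,1)$ are the manifolds with a normal metric contact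
  pair and decomposable \<open>\<phi>\<close>; the bidegree is unrelated to the type \<open>(h, k)\<close>.\<close>

definition hermitian_bicontact_11 ::
  "nat \<Rightarrow> 'a::euclidean_space set \<Rightarrow> nat \<Rightarrow> nat \<Rightarrow> ('a \<Rightarrow> 'a \<Rightarrow> real) \<Rightarrow> ('a \<Rightarrow> 'a \<Rightarrow> real) \<Rightarrow>
   ('a \<Rightarrow> 'a) \<Rightarrow> ('a \<Rightarrow> 'a) \<Rightarrow> ('a \<Rightarrow> 'a \<Rightarrow> 'a) \<Rightarrow> ('a \<Rightarrow> 'a \<Rightarrow> 'a \<Rightarrow> real) \<Rightarrow> bool" where
  "hermitian_bicontact_11 d M h k \<alpha>1 \<alpha>2 Z1 Z2 \<phi> g \<longleftrightarrow>
     metric_contact_pair d M h k \<alpha>1 \<alpha>2 Z1 Z2 \<phi> g \<and>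
     integrable_acs d M (J_structure \<alpha>1 \<alpha>2 Z1 Z2 \<phi>) \<and>
     integrable_acs d M (T_structure \<alpha>1 \<alpha>2 Z1 Z2 \<phi>) \<and>
     decomposable M \<alpha>1 \<alpha>2 \<phi>"

definition complex_submanifold ::
  "nat \<Rightarrow> 'a::euclidean_space set \<Rightarrow> 'a set \<Rightarrow> ('a \<Rightarrow> 'a \<Rightarrow> 'a) \<Rightarrow> bool" where
  "complex_submanifold n N M J \<longleftrightarrow>
     N \<subseteq> M \<and> manifold n N \<and>
     (\<forall>p\<in>N. J p ` tangent_space N p \<subseteq> tangent_space N p)"

end

theory Submission
  imports Defs
begin

text \<open>The example is the Calabi--Eckmann manifold \<open>S\<^sup>3 \<times> S\<^sup>3\<close> inside the product of two copies of
  \<open>\<complex>\<^sup>2\<close>, with the round metric and with the two standard contact forms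
  \<open>\<alpha>\<^sub>1 = \<langle>z, \<i> dz\<rangle>\<close> and \<open>\<alpha>\<^sub>2 = \<langle>w, \<i> dw\<rangle>\<close>. Local holomorphic coordinates for \<open>J\<close> are
  \<open>z\<^sub>2/z\<^sub>1\<close>, \<open>w\<^sub>2/w\<^sub>1\<close> and \<open>log z\<^sub>1 + \<i> log w\<^sub>1\<close>; for \<open>T\<close> the sign of the last term changes. The submanifold
  \<open>N\<close> is the preimage of the diagonal under the Hopf map to \<open>CP\<^sup>1 \<times> CP\<^sup>1\<close>, that is, the set of all
  \<open>(z, cz)\<close> with \<open>|c| = 1\<close>. It has dimension 4, so a contact pair on it has type \<open>(1,0)\<close> or \<open>(0,1)\<close>
  and one of the two forms is closed; but neither form is closed on \<open>N\<close>.\<close>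

section \<open>Calculus of smooth maps\<close>

text \<open>The coordinates come from a group action. For s = 1 or s = -1, the complex numbers act
  holomorphically on pairs of nonzero vectors by t.(z,w) = (exp(t) z, exp(s i t) w). The two factors
  have moduli exp(Re t) and exp(-s Im t), so every orbit meets the product of the unit spheres
  exactly once, and the product inherits the complex structure of the orbit space: J for s = 1, T
  for s = -1. Invariant holomorphic functions are coordinates, and log z1 + s i log w1 is invariant
  because s^2 = 1. The diagonal is chosen for the following reason. The exterior derivative of each
  form is pulled back from an area form on one factor of CP^1 x CP^1. Over a curve that is constant
  in one factor, the corresponding derivative would vanish and a contact pair would survive; the
  diagonal projects isomorphically to both factors, so neither derivative vanishes. The obstacle is
  that exterior derivatives are defined through extensions to vector fields. They become computable
  because both forms are restrictions of expressions that are bilinear in the point and the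
  vector.\<close>

lemma Ck_on_subset: "Ck_on k S f \<Longrightarrow> T \<subseteq> S \<Longrightarrow> Ck_on k T f"
  by (induction k arbitrary: f) (auto intro: continuous_on_subset)

text \<open>Openness of \<open>S\<close> is what carries agreement on \<open>S\<close> over to the
  derivatives, which depend on a whole neighbourhood of each point.\<close>

lemma Ck_on_cong:
  assumes "open S" "Ck_on k S f" "\<And>x. x \<in> S \<Longrightarrow> f x = g x"
  shows "Ck_on k S g"
  using assms(2,3)
proof (induction k arbitrary: f g)
  case 0
  then show ?case by (simp cong: continuous_on_cong)
next
  case (Suc k)
  have der: "(g has_derivative frechet_derivative f (at x)) (at x)" if "x \<in> S" for x
  proof -
    have "(f has_derivative frechet_derivative f (at x)) (at x)"
      using Suc.prems(1) that by (simp add: frechet_derivative_works[symmetric])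
    then show ?thesis
      by (rule has_derivative_transform_within_open[OF _ \<open>open S\<close> that]) (use Suc.prems(2) in auto)
  qed
  have eq: "frechet_derivative f (at x) = frechet_derivative g (at x)" if "x \<in> S" for x
    using frechet_derivative_at[OF der[OF that]] .
  have "Ck_on k S (\<lambda>x. frechet_derivative g (at x) v)" for v
  proof (rule Suc.IH)
    show "Ck_on k S (\<lambda>x. frechet_derivative f (at x) v)" using Suc.prems(1) by simp
  qed (simp add: eq)
  then show ?case using der by (auto simp: differentiable_def)
qed

text \<open>Lets an explicitly given derivative \<open>D\<close> replace the abstract
  \<open>frechet_derivative\<close>; at a point of an open set the two coincide.\<close>

lemma Ck_on_SucI:
  assumes "open S" "\<And>x. x \<in> S \<Longrightarrow> (f has_derivative D x) (at x)" "\<And>v. Ck_on k S (\<lambda>x. D x v)"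
  shows "Ck_on (Suc k) S f"
proof -
  have "Ck_on k S (\<lambda>x. frechet_derivative f (at x) v)" for v
    by (rule Ck_on_cong[OF assms(1) assms(3)[of v]]) (simp add: frechet_derivative_at[OF assms(2), symmetric])
  then show ?thesis using assms(2) by (auto simp: differentiable_def)
qed

lemma Ck_on_SucD: "Ck_on (Suc k) S f \<Longrightarrow> Ck_on k S f"
proof (induction k arbitrary: f)
  case 0
  then show ?case
    by (simp add: differentiable_imp_continuous_on differentiable_at_imp_differentiable_on)
qed auto

lemma Ck_on_has_derivative:
  "Ck_on (Suc k) S f \<Longrightarrow> x \<in> S \<Longrightarrow> (f has_derivative frechet_derivative f (at x)) (at x)"
  by (simp add: frechet_derivative_works[symmetric])

section \<open>Closure properties of maps of class C^k\<close>

lemma Ck_on_const: "Ck_on k S (\<lambda>x. c)"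
  by (induction k arbitrary: c) auto

lemma Ck_on_bounded_linear:
  assumes "bounded_linear f" "open S"
  shows "Ck_on k S f"
proof (cases k)
  case 0
  then show ?thesis using assms by (auto intro: linear_continuous_on)
next
  case (Suc m)
  show ?thesis unfolding Suc
    by (rule Ck_on_SucI[where D = "\<lambda>x. f"])
      (auto intro: assms Ck_on_const bounded_linear_imp_has_derivative)
qed

lemma Ck_on_add:
  assumes "open S" "Ck_on k S f" "Ck_on k S g"
  shows "Ck_on k S (\<lambda>x. f x + g x)"
  using assms(2,3)
proof (induction k arbitrary: f g)
  case 0
  then show ?case by (auto intro: continuous_intros)
next
  case (Suc k)
  show ?case
    by (rule Ck_on_SucI[where D = "\<lambda>x v. frechet_derivative f (at x) v + frechet_derivative g (at x) v"])
      (use Suc assms(1) in \<open>auto intro!: has_derivative_add Ck_on_has_derivative[of k S]\<close>)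
qed

lemma Ck_on_sum:
  assumes "open S" "finite I" "\<And>i. i \<in> I \<Longrightarrow> Ck_on k S (f i)"
  shows "Ck_on k S (\<lambda>x. \<Sum>i\<in>I. f i x)"
  using assms(2,3) by (induction I) (auto intro: Ck_on_const Ck_on_add[OF assms(1)])

lemma Ck_on_bilinear:
  assumes B: "bounded_bilinear B" and S: "open S" and f: "Ck_on k S f" and g: "Ck_on k S g"
  shows "Ck_on k S (\<lambda>x. B (f x) (g x))"
  using f g
proof (induction k arbitrary: f g)
  case 0
  then show ?case using B by (auto intro: bounded_bilinear.continuous_on)
next
  case (Suc k)
  show ?case
  proof (rule Ck_on_SucI[OF S])
    show "((\<lambda>x. B (f x) (g x)) has_derivative
        (\<lambda>v. B (f x) (frechet_derivative g (at x) v) + B (frechet_derivative f (at x) v) (g x))) (at x)"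
      if "x \<in> S" for x
      by (rule bounded_bilinear.FDERIV[OF B Ck_on_has_derivative[OF Suc.prems(1) that]
            Ck_on_has_derivative[OF Suc.prems(2) that]])
    show "Ck_on k S (\<lambda>x. B (f x) (frechet_derivative g (at x) v) + B (frechet_derivative f (at x) v) (g x))"
      for v
      by (intro Ck_on_add[OF S] Suc.IH Ck_on_SucD[OF Suc.prems(1)] Ck_on_SucD[OF Suc.prems(2)])
        (use Suc.prems in auto)
  qed
qed

text \<open>The chain rule applies a point-dependent linear map to a point-dependent vector.
  Expanding that vector in the basis leaves a sum of products in which the derivative of
  \<open>g\<close> is taken along constant vectors only, so the induction hypothesis, which is
  general in \<open>g\<close>, applies to the partial derivatives of \<open>g\<close>.\<close>

lemma Ck_on_compose:
  assumes S: "open S" and T: "open T" and f: "Ck_on k S f" and g: "Ck_on k T g" and sub: "f ` S \<subseteq> T"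
  shows "Ck_on k S (\<lambda>x. g (f x))"
  using f g sub
proof (induction k arbitrary: g)
  case 0
  then show ?case by (auto intro: continuous_on_compose2)
next
  case (Suc k)
  note df = Ck_on_has_derivative[OF Suc.prems(1)] and dg = Ck_on_has_derivative[OF Suc.prems(2)]
  have D: "((\<lambda>x. g (f x)) has_derivative
      (\<lambda>v. \<Sum>b\<in>Basis. (frechet_derivative f (at x) v \<bullet> b) *\<^sub>R frechet_derivative g (at (f x)) b)) (at x)"
    if "x \<in> S" for x
  proof -
    have "f x \<in> T" using Suc.prems(3) that by auto
    then interpret Dg: bounded_linear "frechet_derivative g (at (f x))"
      by (rule has_derivative_bounded_linear[OF dg])
    have comp: "((\<lambda>x. g (f x)) has_derivative
        (\<lambda>v. frechet_derivative g (at (f x)) (frechet_derivative f (at x) v))) (at x)"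
      using has_derivative_compose[OF df[OF that] dg[OF \<open>f x \<in> T\<close>]] .
    have eq: "frechet_derivative g (at (f x)) w =
        (\<Sum>b\<in>Basis. (w \<bullet> b) *\<^sub>R frechet_derivative g (at (f x)) b)" for w
      using Dg.sum[of "\<lambda>b. (w \<bullet> b) *\<^sub>R b" Basis] by (simp add: Dg.scaleR euclidean_representation)
    show ?thesis by (rule has_derivative_eq_rhs[OF comp]) (rule ext, rule eq)
  qed
  have "Ck_on k S (\<lambda>x. frechet_derivative f (at x) v \<bullet> b)" for v and b :: 'b
    by (rule Ck_on_bilinear[OF bounded_bilinear_inner S _ Ck_on_const]) (use Suc.prems(1) in simp)
  moreover have "Ck_on k S (\<lambda>x. frechet_derivative g (at (f x)) b)" for b
    by (rule Suc.IH[OF Ck_on_SucD[OF Suc.prems(1)] _ Suc.prems(3)]) (use Suc.prems(2) in simp)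
  ultimately show ?case
    by (intro Ck_on_SucI[OF S D] Ck_on_sum[OF S] Ck_on_bilinear[OF bounded_bilinear_scaleR S]) auto
qed

lemma Ck_on_inverse:
  "Ck_on k (- {0}) (inverse :: 'a \<Rightarrow> 'a::{euclidean_space,real_normed_field})"
proof (induction k)
  case 0
  then show ?case by (auto intro!: continuous_intros)
next
  case (Suc k)
  show ?case
  proof (rule Ck_on_SucI)
    show "(inverse has_derivative (\<lambda>v. - (inverse x * v * inverse x))) (at x)" if "x \<in> - {0}" for x :: 'a
      using that by (auto intro!: derivative_eq_intros)
    show "Ck_on k (- {0}) (\<lambda>x. - (inverse x * v * inverse x))" for v :: 'a
      using Ck_on_bilinear[OF bounded_bilinear_mult open_Compl[OF closed_singleton] Ck_on_const[of _ _ "-v"]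
          Ck_on_bilinear[OF bounded_bilinear_mult open_Compl[OF closed_singleton] Suc Suc]]
      by (simp add: mult_ac)
  qed auto
qed

lemma Ck_on_exp: "Ck_on k UNIV (exp :: 'a \<Rightarrow> 'a::{euclidean_space,real_normed_field,banach})"
proof (induction k)
  case 0
  then show ?case by (auto intro!: continuous_intros)
next
  case (Suc k)
  show ?case
  proof (rule Ck_on_SucI)
    show "(exp has_derivative (\<lambda>v. exp x * v)) (at x)" for x :: 'a
      using DERIV_exp[of x] by (simp add: has_field_derivative_def)
    show "Ck_on k UNIV (\<lambda>x. exp x * v)" for v :: 'a
      by (rule Ck_on_bilinear[OF bounded_bilinear_mult _ Suc Ck_on_const]) auto
  qed auto
qed

text \<open>Serves the real and the complex logarithm at once.\<close>

lemma Ck_on_if_derivative_inverse: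
  fixes f :: "'a::{euclidean_space,real_normed_field} \<Rightarrow> 'a"
  assumes S: "open S" "0 \<notin> S" and f: "\<And>x. x \<in> S \<Longrightarrow> (f has_field_derivative inverse x) (at x)"
  shows "Ck_on k S f"
proof (cases k)
  case 0
  then show ?thesis
    using f by (auto intro!: continuous_at_imp_continuous_on DERIV_isCont)
next
  case (Suc m)
  show ?thesis unfolding Suc
  proof (rule Ck_on_SucI[OF S(1)])
    show "(f has_derivative (\<lambda>v. inverse x * v)) (at x)" if "x \<in> S" for x
      using f[OF that] by (simp add: has_field_derivative_def)
    show "Ck_on m S (\<lambda>x. inverse x * v)" for v
      by (rule Ck_on_bilinear[OF bounded_bilinear_mult S(1) Ck_on_subset[OF Ck_on_inverse] Ck_on_const])
        (use S in auto)
  qed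
qed

section \<open>Smoothness on arbitrary subsets, through local extensions\<close>

lemma smooth_on_if_Ck_on: "open W \<Longrightarrow> (\<And>k. Ck_on k W f) \<Longrightarrow> S \<subseteq> W \<Longrightarrow> smooth_on S f"
  unfolding smooth_on_def by blast

lemma smooth_onE:
  assumes "smooth_on S f" "x \<in> S"
  obtains W g where "open W" "x \<in> W" "\<And>k. Ck_on k W g" "\<And>y. y \<in> S \<Longrightarrow> y \<in> W \<Longrightarrow> g y = f y"
  using assms unfolding smooth_on_def by (metis IntI)

lemma smooth_onI:
  assumes "\<And>x. x \<in> S \<Longrightarrow>
    \<exists>W g. open W \<and> x \<in> W \<and> (\<forall>k. Ck_on k W g) \<and> (\<forall>y. y \<in> S \<longrightarrow> y \<in> W \<longrightarrow> g y = f y)"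
  shows "smooth_on S f"
  using assms unfolding smooth_on_def by (metis IntD1 IntD2)

lemma smooth_on_subset: "smooth_on S f \<Longrightarrow> T \<subseteq> S \<Longrightarrow> smooth_on T f"
  unfolding smooth_on_def by (rule ballI, drule bspec, erule subsetD, assumption) blast

lemma smooth_on_const: "smooth_on S (\<lambda>x. c)"
  by (rule smooth_on_if_Ck_on[of UNIV]) (auto intro: Ck_on_const)

lemma smooth_on_bounded_linear: "bounded_linear f \<Longrightarrow> smooth_on S f"
  by (rule smooth_on_if_Ck_on[of UNIV]) (auto intro: Ck_on_bounded_linear)

lemma smooth_on_compose:
  assumes f: "smooth_on S f" and g: "smooth_on T g" and sub: "f ` S \<subseteq> T"
  shows "smooth_on S (\<lambda>x. g (f x))"
proof (rule smooth_onI)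
  fix x assume x: "x \<in> S"
  obtain W f' where W: "open W" "x \<in> W" "\<And>k. Ck_on k W f'" "\<And>y. y \<in> S \<Longrightarrow> y \<in> W \<Longrightarrow> f' y = f y"
    using smooth_onE[OF f x] by blast
  have "f x \<in> T" using x sub by auto
  then obtain V g' where V: "open V" "f x \<in> V" "\<And>k. Ck_on k V g'" "\<And>y. y \<in> T \<Longrightarrow> y \<in> V \<Longrightarrow> g' y = g y"
    using smooth_onE[OF g] by blast
  have cont: "continuous_on W f'" using W(3)[of 0] by simp
  let ?W = "W \<inter> f' -` V"
  have op: "open ?W" using cont V(1) W(1) by (simp add: continuous_open_preimage)
  have "Ck_on k ?W (\<lambda>x. g' (f' x))" for k
    by (rule Ck_on_compose[OF op V(1) Ck_on_subset[OF W(3)] V(3)]) auto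
  moreover have "x \<in> ?W" using W x V by auto
  moreover have "\<forall>y. y \<in> S \<longrightarrow> y \<in> ?W \<longrightarrow> g' (f' y) = g (f y)" using W(4) V(4) sub by auto
  ultimately show "\<exists>W h. open W \<and> x \<in> W \<and> (\<forall>k. Ck_on k W h) \<and>
      (\<forall>y. y \<in> S \<longrightarrow> y \<in> W \<longrightarrow> h y = g (f y))"
    using op by blast
qed

lemma smooth_on_linear_compose: "bounded_linear g \<Longrightarrow> smooth_on S f \<Longrightarrow> smooth_on S (\<lambda>x. g (f x))"
  using smooth_on_compose[OF _ smooth_on_bounded_linear[of g UNIV]] by blast

lemma smooth_on_bilinear:
  assumes B: "bounded_bilinear B" and f: "smooth_on S f" and g: "smooth_on S g"
  shows "smooth_on S (\<lambda>x. B (f x) (g x))"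
proof (rule smooth_onI)
  fix x assume x: "x \<in> S"
  obtain W f' where W: "open W" "x \<in> W" "\<And>k. Ck_on k W f'" "\<And>y. y \<in> S \<Longrightarrow> y \<in> W \<Longrightarrow> f' y = f y"
    using smooth_onE[OF f x] by blast
  obtain V g' where V: "open V" "x \<in> V" "\<And>k. Ck_on k V g'" "\<And>y. y \<in> S \<Longrightarrow> y \<in> V \<Longrightarrow> g' y = g y"
    using smooth_onE[OF g x] by blast
  have "Ck_on k (W \<inter> V) (\<lambda>x. B (f' x) (g' x))" for k
    by (rule Ck_on_bilinear[OF B _ Ck_on_subset[OF W(3)] Ck_on_subset[OF V(3)]]) (use W V in auto)
  moreover have "\<forall>y. y \<in> S \<longrightarrow> y \<in> W \<inter> V \<longrightarrow> B (f' y) (g' y) = B (f y) (g y)" using W(4) V(4) by auto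
  ultimately show "\<exists>W h. open W \<and> x \<in> W \<and> (\<forall>k. Ck_on k W h) \<and>
      (\<forall>y. y \<in> S \<longrightarrow> y \<in> W \<longrightarrow> h y = B (f y) (g y))"
    using W(1,2) V(1,2) by (meson IntI open_Int)
qed

lemma smooth_on_add:
  assumes f: "smooth_on S f" and g: "smooth_on S g"
  shows "smooth_on S (\<lambda>x. f x + g x)"
proof (rule smooth_onI)
  fix x assume x: "x \<in> S"
  obtain W f' where W: "open W" "x \<in> W" "\<And>k. Ck_on k W f'" "\<And>y. y \<in> S \<Longrightarrow> y \<in> W \<Longrightarrow> f' y = f y"
    using smooth_onE[OF f x] by blast
  obtain V g' where V: "open V" "x \<in> V" "\<And>k. Ck_on k V g'" "\<And>y. y \<in> S \<Longrightarrow> y \<in> V \<Longrightarrow> g' y = g y"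
    using smooth_onE[OF g x] by blast
  have "Ck_on k (W \<inter> V) (\<lambda>x. f' x + g' x)" for k
    by (rule Ck_on_add[OF _ Ck_on_subset[OF W(3)] Ck_on_subset[OF V(3)]]) (use W V in auto)
  moreover have "\<forall>y. y \<in> S \<longrightarrow> y \<in> W \<inter> V \<longrightarrow> f' y + g' y = f y + g y" using W(4) V(4) by auto
  ultimately show "\<exists>W h. open W \<and> x \<in> W \<and> (\<forall>k. Ck_on k W h) \<and>
      (\<forall>y. y \<in> S \<longrightarrow> y \<in> W \<longrightarrow> h y = f y + g y)"
    using W(1,2) V(1,2) by (meson IntI open_Int)
qed

lemma smooth_on_diff:
  "smooth_on S f \<Longrightarrow> smooth_on S g \<Longrightarrow> smooth_on S (\<lambda>x. f x - g x)"
  using smooth_on_add[of S f "\<lambda>x. - g x"] smooth_on_linear_compose[OF bounded_linear_minus[OF bounded_linear_ident]]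
  by fastforce

lemma smooth_on_Pair:
  assumes f: "smooth_on S f" and g: "smooth_on S g"
  shows "smooth_on S (\<lambda>x. (f x, g x))"
proof -
  have "smooth_on S (\<lambda>x. (f x, 0))" "smooth_on S (\<lambda>x. (0, g x))"
    by (intro smooth_on_linear_compose[OF _ f] smooth_on_linear_compose[OF _ g]
        bounded_linear_Pair bounded_linear_ident bounded_linear_zero)+
  from smooth_on_add[OF this] show ?thesis by simp
qed

lemmas smooth_on_id = smooth_on_bounded_linear[OF bounded_linear_ident]
lemmas smooth_on_fst = smooth_on_linear_compose[OF bounded_linear_fst]
lemmas smooth_on_snd = smooth_on_linear_compose[OF bounded_linear_snd]
lemmas smooth_on_Re = smooth_on_linear_compose[OF bounded_linear_Re]
lemmas smooth_on_Im = smooth_on_linear_compose[OF bounded_linear_Im]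
lemmas smooth_on_of_real = smooth_on_linear_compose[OF bounded_linear_of_real]
lemmas smooth_on_mult = smooth_on_bilinear[OF bounded_bilinear_mult]
lemmas smooth_on_scaleR = smooth_on_bilinear[OF bounded_bilinear_scaleR]
lemmas smooth_on_inner = smooth_on_bilinear[OF bounded_bilinear_inner]

lemma smooth_on_inverse:
  fixes f :: "'a::euclidean_space \<Rightarrow> 'b::{euclidean_space,real_normed_field}"
  shows "smooth_on S f \<Longrightarrow> (\<And>x. x \<in> S \<Longrightarrow> f x \<noteq> 0) \<Longrightarrow> smooth_on S (\<lambda>x. inverse (f x))"
  by (rule smooth_on_compose[where T = "- {0}"])
    (auto intro: smooth_on_if_Ck_on[of "- {0}"] Ck_on_inverse)

lemma smooth_on_divide:
  fixes f :: "'a::euclidean_space \<Rightarrow> 'b::{euclidean_space,real_normed_field}"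
  shows "smooth_on S f \<Longrightarrow> smooth_on S g \<Longrightarrow> (\<And>x. x \<in> S \<Longrightarrow> g x \<noteq> 0) \<Longrightarrow> smooth_on S (\<lambda>x. f x / g x)"
  by (simp add: divide_inverse smooth_on_mult smooth_on_inverse)

lemma smooth_on_exp:
  fixes f :: "'a::euclidean_space \<Rightarrow> 'b::{euclidean_space,real_normed_field,banach}"
  shows "smooth_on S f \<Longrightarrow> smooth_on S (\<lambda>x. exp (f x))"
  by (rule smooth_on_compose[where T = UNIV]) (auto intro: smooth_on_if_Ck_on[of UNIV] Ck_on_exp)

lemma smooth_on_ln:
  assumes "smooth_on S f" "\<And>x. x \<in> S \<Longrightarrow> f x > 0"
  shows "smooth_on S (\<lambda>x. ln (f x :: real))"
proof (rule smooth_on_compose[OF assms(1)])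
  show "smooth_on {0<..} (ln :: real \<Rightarrow> real)"
    by (rule smooth_on_if_Ck_on[OF open_greaterThan Ck_on_if_derivative_inverse])
      (auto intro!: derivative_eq_intros simp: divide_simps)
qed (use assms in auto)

lemma smooth_on_Ln:
  assumes "smooth_on S f" "\<And>x. x \<in> S \<Longrightarrow> Re (f x) > 0"
  shows "smooth_on S (\<lambda>x. Ln (f x))"
proof (rule smooth_on_compose[OF assms(1)])
  show "smooth_on {z. Re z > 0} Ln"
    by (rule smooth_on_if_Ck_on[OF open_halfspace_Re_gt Ck_on_if_derivative_inverse])
      (auto intro!: has_field_derivative_Ln simp: open_halfspace_Re_gt complex_nonpos_Reals_iff)
qed (use assms in auto)

lemmas smooth_intros = smooth_on_const smooth_on_id smooth_on_add smooth_on_diff smooth_on_Pair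
  smooth_on_fst smooth_on_snd smooth_on_Re smooth_on_Im smooth_on_of_real smooth_on_mult
  smooth_on_scaleR smooth_on_inner smooth_on_divide smooth_on_exp smooth_on_ln smooth_on_Ln

lemma smooth_on_has_derivative:
  assumes "smooth_on S f" "x \<in> S"
  obtains D where "(f has_derivative D) (at x within S)"
proof -
  obtain W g where W: "open W" "x \<in> W" "\<And>k. Ck_on k W g" "\<And>y. y \<in> S \<Longrightarrow> y \<in> W \<Longrightarrow> g y = f y"
    using smooth_onE[OF assms] by blast
  have "(g has_derivative frechet_derivative g (at x)) (at x within S)"
    using Ck_on_has_derivative[OF W(3) W(2)] has_derivative_at_withinI by blast
  moreover obtain e where "e > 0" "ball x e \<subseteq> W" using W(1,2) openE by blast
  ultimately have "(f has_derivative frechet_derivative g (at x)) (at x within S)"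
    using assms(2) W(4) by (elim has_derivative_transform_within[of _ _ _ _ e]) (auto simp: dist_commute subset_iff)
  then show ?thesis by (rule that)
qed

section \<open>Manifolds and bilinear forms\<close>

lemma tangent_space_subset: "N \<subseteq> M \<Longrightarrow> tangent_space N p \<subseteq> tangent_space M p"
  unfolding tangent_space_def by blast

text \<open>A derivative within \<open>M\<close> is enough for the chain rule because the curve
  never leaves \<open>M\<close>.\<close>

lemma tangent_has_vector_derivative:
  assumes "(f has_derivative D) (at p within M)"
    and "\<epsilon> > 0" "\<gamma> ` {-\<epsilon><..<\<epsilon>} \<subseteq> M" "\<gamma> 0 = p" "(\<gamma> has_vector_derivative v) (at 0)"
  shows "(f \<circ> \<gamma> has_vector_derivative D v) (at 0)"
proof -
  interpret D: bounded_linear D by (rule has_derivative_bounded_linear[OF assms(1)])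
  let ?I = "{-\<epsilon><..<\<epsilon>}"
  have at: "at 0 within ?I = at 0" using assms(2) by (intro at_within_open) auto
  have "(\<gamma> has_derivative (\<lambda>t. t *\<^sub>R v)) (at 0 within ?I)"
    using assms(5) at by (simp add: has_vector_derivative_def)
  moreover have "(f has_derivative D) (at (\<gamma> 0) within \<gamma> ` ?I)"
    using assms(1,3,4) by (auto intro: has_derivative_subset)
  ultimately have "(f \<circ> \<gamma> has_derivative D \<circ> (\<lambda>t. t *\<^sub>R v)) (at 0 within ?I)"
    by (rule diff_chain_within)
  then show ?thesis using at by (simp add: has_vector_derivative_def o_def D.scaleR)
qed

text \<open>Derivatives within \<open>M\<close> may differ off the tangent space. Along a curve in
  \<open>M\<close>, however, each of them yields the velocity of the image curve, which is unique;
  so any explicit derivative computes \<open>differential\<close> on tangent vectors.\<close>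

lemma differential_eq:
  assumes "(f has_derivative D) (at p within M)" "v \<in> tangent_space M p"
  shows "differential M f p v = D v"
proof -
  obtain \<gamma> \<epsilon> where \<gamma>: "\<epsilon> > 0" "\<gamma> ` {-\<epsilon><..<\<epsilon>} \<subseteq> M" "\<gamma> 0 = p" "(\<gamma> has_vector_derivative v) (at 0)"
    using assms(2) unfolding tangent_space_def by blast
  have F: "(f has_derivative frechet_derivative f (at p within M)) (at p within M)"
    using assms(1) by (metis differentiableI frechet_derivative_works)
  show ?thesis
    unfolding differential_def
    using tangent_has_vector_derivative[OF F \<gamma>] tangent_has_vector_derivative[OF assms(1) \<gamma>]
    by (rule vector_derivative_unique_at)
qed

text \<open>By the product rule, the derivative of \<open>B q (Y q)\<close> along X is
  \<open>B p (DY (X p)) + B (X p) (Y p)\<close>. The terms with \<open>DX\<close> and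
  \<open>DY\<close> cancel against the Lie bracket. What remains depends on \<open>u\<close> and
  \<open>v\<close> only, so the definite description in \<open>ext_deriv\<close> denotes this value
  as soon as one pair of extending fields exists.\<close>

lemma ext_deriv_bilinear:
  assumes B: "bounded_bilinear B" and p: "p \<in> M"
    and X: "vector_field M X" "X p = u" and Y: "vector_field M Y" "Y p = v"
  shows "ext_deriv M B p u v = 1/2 * (B u v - B v u)"
proof -
  have *: "1/2 * (differential M (\<lambda>q. B q (Y q)) p (X p) - differential M (\<lambda>q. B q (X q)) p (Y p)
      - B p (lie_bracket M X Y p)) = 1/2 * (B (X p) (Y p) - B (Y p) (X p))"
    if X: "vector_field M X" and Y: "vector_field M Y" for X Y
  proof -
    obtain DX DY where D: "(X has_derivative DX) (at p within M)" "(Y has_derivative DY) (at p within M)"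
      using X Y p smooth_on_has_derivative unfolding vector_field_def by metis
    have t: "X p \<in> tangent_space M p" "Y p \<in> tangent_space M p"
      using X Y p unfolding vector_field_def by auto
    have "differential M (\<lambda>q. B q (Y q)) p (X p) = B p (DY (X p)) + B (X p) (Y p)"
      by (rule differential_eq[OF bounded_bilinear.FDERIV[OF B has_derivative_ident D(2)] t(1)])
    moreover have "differential M (\<lambda>q. B q (X q)) p (Y p) = B p (DX (Y p)) + B (Y p) (X p)"
      by (rule differential_eq[OF bounded_bilinear.FDERIV[OF B has_derivative_ident D(1)] t(2)])
    moreover have "lie_bracket M X Y p = DY (X p) - DX (Y p)"
      unfolding lie_bracket_def using differential_eq[OF D(1) t(2)] differential_eq[OF D(2) t(1)] by simp
    ultimately show ?thesis by (simp add: bounded_bilinear.diff_right[OF B])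
  qed
  show ?thesis unfolding ext_deriv_def
  proof (rule the_equality)
    show "\<exists>X Y. vector_field M X \<and> vector_field M Y \<and> X p = u \<and> Y p = v \<and>
        1/2 * (B u v - B v u) = 1/2 * (differential M (\<lambda>q. B q (Y q)) p (X p)
          - differential M (\<lambda>q. B q (X q)) p (Y p) - B p (lie_bracket M X Y p))"
      by (intro exI[of _ X] exI[of _ Y] conjI X Y) (use *[OF X(1) Y(1)] X(2) Y(2) in simp)
  next
    fix r
    assume "\<exists>X Y. vector_field M X \<and> vector_field M Y \<and> X p = u \<and> Y p = v \<and>
        r = 1/2 * (differential M (\<lambda>q. B q (Y q)) p (X p)
          - differential M (\<lambda>q. B q (X q)) p (Y p) - B p (lie_bracket M X Y p))"
    then obtain X Y where XY: "vector_field M X" "vector_field M Y" "X p = u" "Y p = v"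
      and r: "r = 1/2 * (differential M (\<lambda>q. B q (Y q)) p (X p)
          - differential M (\<lambda>q. B q (X q)) p (Y p) - B p (lie_bracket M X Y p))"
      by blast
    show "r = 1/2 * (B u v - B v u)" using trans[OF r *[OF XY(1,2)]] by (simp only: XY(3,4))
  qed
qed

lemma one_form_bilinear:
  assumes B: "bounded_bilinear B"
  shows "one_form M B"
  unfolding one_form_def
proof (intro conjI ballI allI impI)
  fix p show "linear_on_subspace (tangent_space M p) (B p)"
    by (simp add: linear_on_subspace_def bounded_bilinear.add_right[OF B] bounded_bilinear.scaleR_right[OF B])
  fix X assume "vector_field M X"
  then show "smooth_on M (\<lambda>p. B p (X p))"
    unfolding vector_field_def by (intro smooth_on_bilinear[OF B] smooth_on_id) auto
qed

lemma diffeo_subset: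
  assumes "diffeo A B f" "A' \<subseteq> A"
  shows "diffeo A' (f ` A') f"
proof -
  obtain g where g: "smooth_on A f" "smooth_on B g" "f ` A = B" "g ` B = A"
      "\<forall>x\<in>A. g (f x) = x" "\<forall>y\<in>B. f (g y) = y"
    using assms(1) unfolding diffeo_def by blast
  have "smooth_on A' f" "smooth_on (f ` A') g"
    using smooth_on_subset[OF g(1) assms(2)] smooth_on_subset[OF g(2), of "f ` A'"] g(3) assms(2) by auto
  moreover have "g ` f ` A' = A'" using g(5) assms(2) by force
  moreover have "\<forall>x\<in>A'. g (f x) = x" "\<forall>y\<in>f ` A'. f (g y) = y" using g(5) assms(2) by auto
  ultimately show ?thesis unfolding diffeo_def by blast
qed

section \<open>Wedge products\<close>

text \<open>Substituting \<open>\<pi> \<circ> \<sigma>\<close> for the summation variable only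
  changes the sign, so a wedge product is alternating whatever its factors are.\<close>

lemma wedge_permute:
  assumes \<pi>: "\<pi> permutes {..<k + l}"
  shows "wedge k l \<omega> \<eta> (\<lambda>i. v (\<pi> i)) = of_int (sign \<pi>) * wedge k l \<omega> \<eta> v"
proof -
  let ?S = "{\<sigma>. \<sigma> permutes {..<k + l}}"
  let ?f = "\<lambda>\<sigma>. of_int (sign \<sigma>) * \<omega> (\<lambda>i. v (\<sigma> i)) * \<eta> (\<lambda>i. v (\<sigma> (k + i)))"
  have perm: "permutation \<sigma>" if "\<sigma> \<in> ?S" for \<sigma>
    using that by (auto intro: permutation_permutes[THEN iffD2])
  have sgn: "sign (\<pi> \<circ> \<sigma>) = sign \<pi> * sign \<sigma>" if "\<sigma> \<in> ?S" for \<sigma>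
    using that \<pi> perm by (intro sign_compose) auto
  have "(\<Sum>\<sigma>\<in>?S. ?f \<sigma>) = (\<Sum>\<sigma>\<in>?S. ?f (\<pi> \<circ> \<sigma>))"
    by (rule setum_permutations_compose_left[OF \<pi>, where f = ?f])
  also have "\<dots> = of_int (sign \<pi>) *
      (\<Sum>\<sigma>\<in>?S. of_int (sign \<sigma>) * \<omega> (\<lambda>i. v (\<pi> (\<sigma> i))) * \<eta> (\<lambda>i. v (\<pi> (\<sigma> (k + i)))))"
    by (simp add: sum_distrib_left sgn mult_ac cong: sum.cong_simp)
  finally have "(\<Sum>\<sigma>\<in>?S. of_int (sign \<sigma>) * \<omega> (\<lambda>i. v (\<pi> (\<sigma> i))) * \<eta> (\<lambda>i. v (\<pi> (\<sigma> (k + i))))) =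
      of_int (sign \<pi>) * (\<Sum>\<sigma>\<in>?S. ?f \<sigma>)"
    by (simp add: mult.assoc[symmetric] of_int_mult[symmetric] del: of_int_mult)
  then show ?thesis unfolding wedge_def by simp
qed

text \<open>Such a permutation factors into one that moves only the first block and one,
  \<open>\<tau>\<close>, that moves only the second. Shifting the second block down by
  \<open>k\<close> conjugates \<open>\<tau>\<close> into \<open>\<sigma>2\<close> and preserves its
  sign.\<close>

lemma sign_block_permutation:
  fixes \<sigma> :: "nat \<Rightarrow> nat"
  assumes \<sigma>: "\<sigma> permutes {..<k + l}" and blk: "\<sigma> ` {..<k} = {..<k}"
  obtains \<sigma>1 \<sigma>2 where "\<sigma>1 permutes {..<k}" "\<sigma>2 permutes {..<l}"
    "\<And>i. i < k \<Longrightarrow> \<sigma> i = \<sigma>1 i" "\<And>i. i < l \<Longrightarrow> \<sigma> (k + i) = k + \<sigma>2 i" "sign \<sigma> = sign \<sigma>1 * sign \<sigma>2"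
proof -
  have inj: "inj \<sigma>" using \<sigma> by (simp add: permutes_inj)
  have img: "\<sigma> ` {..<k + l} = {..<k + l}" by (rule permutes_image[OF \<sigma>])
  have "{k..<k + l} = {..<k + l} - {..<k}" by auto
  then have blk2: "\<sigma> ` {k..<k + l} = {k..<k + l}"
    by (simp only: image_set_diff[OF inj] img blk)
  define \<sigma>1 where "\<sigma>1 i = (if i < k then \<sigma> i else i)" for i
  define \<tau> where "\<tau> i = (if i < k then i else \<sigma> i)" for i
  have bij1: "bij_betw \<sigma>1 {..<k} {..<k}" unfolding bij_betw_def
    using inj blk by (auto simp: \<sigma>1_def inj_on_def)
  have p1: "\<sigma>1 permutes {..<k}" by (rule bij_imp_permutes[OF bij1]) (auto simp: \<sigma>1_def)
  have bij\<tau>: "bij_betw \<tau> {k..<k + l} {k..<k + l}" unfolding bij_betw_def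
  proof
    show "inj_on \<tau> {k..<k + l}" using inj by (auto simp: \<tau>_def inj_on_def)
    have "\<tau> ` {k..<k + l} = \<sigma> ` {k..<k + l}" by (rule image_cong) (auto simp: \<tau>_def)
    then show "\<tau> ` {k..<k + l} = {k..<k + l}" using blk2 by simp
  qed
  have p\<tau>: "\<tau> permutes {k..<k + l}"
    by (rule bij_imp_permutes[OF bij\<tau>]) (use \<sigma> in \<open>auto simp: \<tau>_def permutes_def\<close>)
  have comp: "\<sigma> = \<sigma>1 \<circ> \<tau>"
  proof
    fix i show "\<sigma> i = (\<sigma>1 \<circ> \<tau>) i"
    proof (cases "i < k")
      case False
      have "\<not> \<sigma> i < k" using blk inj False by (metis imageE injD lessThan_iff)
      then show ?thesis using False by (simp add: \<sigma>1_def \<tau>_def)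
    qed (simp add: \<sigma>1_def \<tau>_def)
  qed
  define \<sigma>2 where "\<sigma>2 = map_permutation {k..<k + l} (\<lambda>i. i - k) \<tau>"
  have inj': "inj_on (\<lambda>i. i - k) {k..<k + l}" by (auto simp: inj_on_def)
  have "bij_betw (\<lambda>i. i - k) {k..<k + l} {..<l}"
    by (rule bij_betw_byWitness[where f' = "\<lambda>i. i + k"]) auto
  then have p2: "\<sigma>2 permutes {..<l}" unfolding \<sigma>2_def by (rule map_permutation_permutes[OF _ p\<tau>])
  have s: "sign \<sigma> = sign \<sigma>1 * sign \<sigma>2"
    unfolding comp \<sigma>2_def using p1 p\<tau> inj'
    by (subst sign_map_permutation[OF inj' p\<tau>])
      (auto intro!: sign_compose permutation_permutes[THEN iffD2])
  have "\<sigma> (k + i) = k + \<sigma>2 i" if "i < l" for i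
  proof -
    have "\<sigma>2 i = \<tau> (k + i) - k"
      using map_permutation_apply[OF inj', of "k + i" \<tau>] that by (simp add: \<sigma>2_def)
    moreover have "\<tau> (k + i) \<ge> k" using permutes_in_image[OF p\<tau>, of "k + i"] that by simp
    ultimately show ?thesis by (simp add: \<tau>_def)
  qed
  then show ?thesis using that p1 p2 s by (auto simp: \<sigma>1_def)
qed

text \<open>By \<open>van\<close>, a summand can be nonzero only if its permutation preserves the
  first block. Alternation of both factors then makes every sign occur squared, so each such summand
  equals the product of the two positive values in \<open>pos\<close>. Non-vanishing follows without
  counting summands.\<close>

lemma wedge_pos:
  assumes alt1: "\<And>\<pi>. \<pi> permutes {..<k} \<Longrightarrow> \<omega> (\<lambda>i. v (\<pi> i)) = of_int (sign \<pi>) * \<omega> v"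
    and alt2: "\<And>\<pi>. \<pi> permutes {..<l} \<Longrightarrow> \<eta> (\<lambda>i. v (k + \<pi> i)) = of_int (sign \<pi>) * \<eta> (\<lambda>i. v (k + i))"
    and loc1: "\<And>v w. (\<And>i. i < k \<Longrightarrow> v i = w i) \<Longrightarrow> \<omega> v = \<omega> w"
    and loc2: "\<And>v w. (\<And>i. i < l \<Longrightarrow> v i = w i) \<Longrightarrow> \<eta> v = \<eta> w"
    and pos: "\<omega> v > 0" "\<eta> (\<lambda>i. v (k + i)) > 0"
    and van: "\<And>\<sigma>. \<sigma> permutes {..<k + l} \<Longrightarrow> \<omega> (\<lambda>i. v (\<sigma> i)) \<noteq> 0 \<Longrightarrow> \<sigma> ` {..<k} \<subseteq> {..<k}"
  shows "wedge k l \<omega> \<eta> v > 0"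
proof -
  let ?f = "\<lambda>\<sigma>. of_int (sign \<sigma>) * \<omega> (\<lambda>i. v (\<sigma> i)) * \<eta> (\<lambda>i. v (\<sigma> (k + i)))"
  have "?f \<sigma> \<ge> 0" if \<sigma>: "\<sigma> permutes {..<k + l}" for \<sigma>
  proof (cases "\<omega> (\<lambda>i. v (\<sigma> i)) = 0")
    case False
    have "\<sigma> ` {..<k} = {..<k}"
      using van[OF \<sigma> False] permutes_inj_on[OF \<sigma>] by (intro endo_inj_surj) auto
    then obtain \<sigma>1 \<sigma>2 where s: "\<sigma>1 permutes {..<k}" "\<sigma>2 permutes {..<l}"
        "\<And>i. i < k \<Longrightarrow> \<sigma> i = \<sigma>1 i" "\<And>i. i < l \<Longrightarrow> \<sigma> (k + i) = k + \<sigma>2 i" "sign \<sigma> = sign \<sigma>1 * sign \<sigma>2"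
      using sign_block_permutation[OF \<sigma>] by blast
    have "\<omega> (\<lambda>i. v (\<sigma> i)) = \<omega> (\<lambda>i. v (\<sigma>1 i))" by (rule loc1) (simp add: s)
    moreover have "\<eta> (\<lambda>i. v (\<sigma> (k + i))) = \<eta> (\<lambda>i. v (k + \<sigma>2 i))" by (rule loc2) (simp add: s)
    ultimately have "?f \<sigma> = (of_int (sign \<sigma>1 * sign \<sigma>1)) * (of_int (sign \<sigma>2 * sign \<sigma>2)) *
        (\<omega> v * \<eta> (\<lambda>i. v (k + i)))"
      by (simp add: alt1[OF s(1)] alt2[OF s(2)] s(5) mult_ac del: sign_idempotent)
    also have "\<dots> = \<omega> v * \<eta> (\<lambda>i. v (k + i))" by (simp only: sign_idempotent of_int_1 mult_1)
    finally show ?thesis using pos by simp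
  qed simp
  moreover have "?f id > 0" using pos by simp
  ultimately have "(\<Sum>\<sigma> | \<sigma> permutes {..<k + l}. ?f \<sigma>) > 0"
    by (intro sum_pos2[where i = id]) (auto simp: finite_permutations permutes_id)
  then show ?thesis unfolding wedge_def by simp
qed

text \<open>Forms here take infinite sequences of vectors, so dependence on the first entries alone
  has to be carried through every product.\<close>

lemma wedge_cong:
  assumes loc1: "\<And>v w. (\<And>i. i < k \<Longrightarrow> v i = w i) \<Longrightarrow> \<omega> v = \<omega> w"
    and loc2: "\<And>v w. (\<And>i. i < l \<Longrightarrow> v i = w i) \<Longrightarrow> \<eta> v = \<eta> w"
    and eq: "\<And>i. i < k + l \<Longrightarrow> v i = w i"
  shows "wedge k l \<omega> \<eta> v = wedge k l \<omega> \<eta> w"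
proof -
  have "\<omega> (\<lambda>i. v (\<sigma> i)) = \<omega> (\<lambda>i. w (\<sigma> i))" "\<eta> (\<lambda>i. v (\<sigma> (k + i))) = \<eta> (\<lambda>i. w (\<sigma> (k + i)))"
    if \<sigma>: "\<sigma> permutes {..<k + l}" for \<sigma>
  proof -
    have "v (\<sigma> i) = w (\<sigma> i)" if "i < k + l" for i
      by (rule eq) (use permutes_in_image[OF \<sigma>, of i] that in simp)
    then show "\<omega> (\<lambda>i. v (\<sigma> i)) = \<omega> (\<lambda>i. w (\<sigma> i))"
      "\<eta> (\<lambda>i. v (\<sigma> (k + i))) = \<eta> (\<lambda>i. w (\<sigma> (k + i)))" by (auto intro!: loc1 loc2)
  qed
  then show ?thesis unfolding wedge_def by (simp cong: sum.cong_simp)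
qed

lemma permutes_lessThan_2: "{\<sigma>. \<sigma> permutes {..<2::nat}} = {id, Transposition.transpose 0 1}"
proof -
  have "{..<2::nat} = insert 0 {1}" by auto
  then have "{\<sigma>. \<sigma> permutes {..<2::nat}} =
      (\<lambda>(b, p). Transposition.transpose 0 b \<circ> p) ` {(b, p). b \<in> insert 0 {1} \<and> p \<in> {id}}"
    by (simp only: permutes_insert permutes_sing mem_Collect_eq) (simp only: singleton_iff)
  also have "{(b, p). b \<in> insert 0 {1} \<and> p \<in> {id}} = {(0::nat, id::nat \<Rightarrow> nat), (1, id)}" by blast
  finally show ?thesis by (simp del: One_nat_def)
qed

text \<open>The first power is the product with the constant 0-form 1, hence the antisymmetrisation
  of \<open>\<omega>\<close> and not \<open>\<omega>\<close> itself.\<close>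

lemma wedge_power_2_one: "wedge_power 2 (as_2form \<omega>) 1 v = (\<omega> (v 0) (v 1) - \<omega> (v 1) (v 0)) / 2"
proof -
  have "id \<noteq> Transposition.transpose 0 (1::nat)"
    by (metis id_apply transpose_apply_first zero_neq_one)
  then show ?thesis
    by (simp add: wedge_def permutes_lessThan_2 as_2form_def sign_swap_id del: One_nat_def)
      (simp add: wedge_def permutes_lessThan_2 as_2form_def sign_swap_id)
qed

text \<open>The Pluecker relation for a form of rank two.\<close>

lemma wedge_power_2_two_eq_0:
  assumes "\<And>i j. i < 4 \<Longrightarrow> j < 4 \<Longrightarrow> \<omega> (v i) (v j) = a i * b j - b i * (a j :: real)"
  shows "wedge_power 2 (as_2form \<omega>) 2 v = 0"
proof -
  let ?f = "\<lambda>i j. a i * b j - b i * a j"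
  have "wedge_power 2 (as_2form \<omega>) 2 v =
     (\<Sum>\<sigma> | \<sigma> permutes {..<4}. of_int (sign \<sigma>) * \<omega> (v (\<sigma> 0)) (v (\<sigma> 1)) *
        ((\<omega> (v (\<sigma> 2)) (v (\<sigma> 3)) - \<omega> (v (\<sigma> 3)) (v (\<sigma> 2))) / 2)) / fact 4"
  proof -
    have "wedge_power 2 (as_2form \<omega>) 2 = wedge_power 2 (as_2form \<omega>) (Suc 1)" by (simp only: Suc_1)
    also have "\<dots> = wedge 2 2 (as_2form \<omega>) (wedge_power 2 (as_2form \<omega>) 1)"
      by (subst wedge_power.simps(2)) (simp only: mult_1_right)
    finally show ?thesis
      by (simp add: wedge_def[of 2 2] wedge_power_2_one as_2form_def del: One_nat_def wedge_power.simps add_2_eq_Suc add_2_eq_Suc')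
  qed
  also have "\<dots> = (\<Sum>\<sigma> | \<sigma> permutes {..<4}. of_int (sign \<sigma>) * ?f (\<sigma> 0) (\<sigma> 1) * ?f (\<sigma> 2) (\<sigma> 3)) / fact 4"
  proof -
    have "\<sigma> i < 4" if "\<sigma> permutes {..<4}" "i < 4" for \<sigma> and i :: nat
      using permutes_in_image[OF that(1), of i] that(2) by simp
    then show ?thesis by (intro arg_cong2[where f = "(/)"] sum.cong refl) (simp add: assms field_simps)
  qed
  also have "(\<Sum>\<sigma> | \<sigma> permutes {..<4}. of_int (sign \<sigma>) * ?f (\<sigma> 0) (\<sigma> 1) * ?f (\<sigma> 2) (\<sigma> 3)) = 0"
  proof -
    \<comment> \<open>The permutations of four indices are unfolded into products of transpositions;
      the signed sum is then a polynomial in the \<open>a i\<close> and \<open>b j\<close> that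
      cancels identically.\<close>
    have s: "{..<4::nat} = insert 0 (insert 1 (insert 2 {3}))" by auto
    have f: "finite {1::nat,2,3}" "0 \<notin> {1::nat,2,3}" "finite {2::nat,3}" "1 \<notin> {2::nat,3}"
      "finite {3::nat}" "2 \<notin> {3::nat}" by auto
    have sgn: "sign (Transposition.transpose a b \<circ> q) = sign (Transposition.transpose a b) * sign q"
      if "permutation q" for a b :: nat and q
      using that by (intro sign_compose) (auto intro: permutation_swap_id)
    show ?thesis
      unfolding s sum_over_permutations_insert[OF f(1,2)] sum_over_permutations_insert[OF f(3,4)]
        sum_over_permutations_insert[OF f(5,6)]
      by (simp add: sgn permutation_swap_id permutation_compose sign_swap_id
          Transposition.transpose_def algebra_simps del: One_nat_def)
  qed
  finally show ?thesis by simp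
qed

section \<open>Complex scalars\<close>

type_synonym C2 = "complex \<times> complex"

definition cm :: "complex \<Rightarrow> C2 \<Rightarrow> C2" where
  "cm c x = (c * fst x, c * snd x)"

lemma norm_cm: "norm (cm c x) = norm c * norm x"
  by (simp add: cm_def norm_prod_def norm_mult power_mult_distrib real_sqrt_mult flip: distrib_left)

lemma bounded_bilinear_cm: "bounded_bilinear cm"
proof
  show "\<exists>K. \<forall>a b. norm (cm a b) \<le> norm a * norm b * K"
    by (intro exI[of _ 1]) (simp add: norm_cm)
qed (auto simp: cm_def algebra_simps)

lemmas bounded_linear_cm = bounded_bilinear.bounded_linear_right[OF bounded_bilinear_cm]
lemmas smooth_on_cm = smooth_on_bilinear[OF bounded_bilinear_cm]
lemmas cm_add = bounded_bilinear.add_right[OF bounded_bilinear_cm]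
lemmas cm_diff = bounded_bilinear.diff_right[OF bounded_bilinear_cm]
lemmas cm_minus = bounded_bilinear.minus_right[OF bounded_bilinear_cm]
lemmas cm_scaleR = bounded_bilinear.scaleR_right[OF bounded_bilinear_cm]
lemmas cm_zero = bounded_bilinear.zero_right[OF bounded_bilinear_cm]

lemma cm_cm: "cm c (cm d x) = cm (c * d) x"
  by (simp add: cm_def)

lemma cm_1: "cm 1 x = x"
  by (simp add: cm_def)

lemma cm_ii_ii: "cm \<i> (cm \<i> x) = - x"
  by (simp add: cm_def uminus_prod_def)

lemma cm_conv: "cm c x = Re c *\<^sub>R x + Im c *\<^sub>R cm \<i> x"
  by (simp add: cm_def complex_eq_iff prod_eq_iff)

lemma inner_cm_ii_left: "cm \<i> x \<bullet> y = - (x \<bullet> cm \<i> y)"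
  by (simp add: cm_def inner_prod_def inner_complex_def)

lemma inner_cm_ii_self: "x \<bullet> cm \<i> x = 0"
  by (simp add: cm_def inner_prod_def inner_complex_def)

lemmas C2_simps = cm_add cm_diff cm_minus cm_scaleR cm_zero cm_ii_ii inner_cm_ii_left inner_cm_ii_self
  inner_simps

section \<open>The product of two spheres\<close>

definition S3xS3 :: "(C2 \<times> C2) set" where
  "S3xS3 = sphere 0 1 \<times> sphere 0 1"

lemma S3xS3_iff: "p \<in> S3xS3 \<longleftrightarrow> fst p \<bullet> fst p = 1 \<and> snd p \<bullet> snd p = 1"
  by (cases p) (simp add: S3xS3_def norm_eq_1)

text \<open>Turns a defining equation of \<open>M\<close> into a linear condition on tangent
  vectors: the zero map is also a derivative of \<open>f\<close> within \<open>M\<close>, and all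
  such derivatives agree on the tangent space.\<close>

lemma tangent_constant:
  fixes f :: "'a::euclidean_space \<Rightarrow> 'b::euclidean_space"
  assumes "(f has_derivative D) (at p within M)" "p \<in> M" "\<And>q. q \<in> M \<Longrightarrow> f q = c"
    and "v \<in> tangent_space M p"
  shows "D v = 0"
proof -
  have "(f has_derivative (\<lambda>v. 0)) (at p within M)"
    by (rule has_derivative_transform[OF assms(2) _ has_derivative_const[of c]]) (simp add: assms(3))
  from differential_eq[OF this assms(4)] show ?thesis
    using differential_eq[OF assms(1,4)] by simp
qed

text \<open>The normalisation of the straight line \<open>z + t X\<close>, which has norm \<open>sqrt (1 + t\<^sup>2 |X|\<^sup>2)\<close> when \<open>X\<close> is
  orthogonal to the unit vector \<open>z\<close>.\<close>

definition sphere_curve :: "'a::real_inner \<Rightarrow> 'a \<Rightarrow> real \<Rightarrow> 'a" where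
  "sphere_curve z X t = exp ((- 1 / 2) * ln (1 + t * t * (X \<bullet> X))) *\<^sub>R (z + t *\<^sub>R X)"

lemma norm_factor_pos: "(0::real) < 1 + t * t * (X \<bullet> X)"
  by (simp add: add_pos_nonneg)

lemma sphere_curve:
  assumes "z \<bullet> z = 1" "z \<bullet> X = 0"
  shows "sphere_curve z X 0 = z" "sphere_curve z X t \<bullet> sphere_curve z X t = 1"
    "(sphere_curve z X has_vector_derivative X) (at 0)"
proof -
  show "sphere_curve z X 0 = z" by (simp add: sphere_curve_def)
  have "exp ((- 1 / 2) * ln (1 + t * t * (X \<bullet> X))) * exp ((- 1 / 2) * ln (1 + t * t * (X \<bullet> X))) =
      exp (- ln (1 + t * t * (X \<bullet> X)))"
    by (simp only: exp_add[symmetric]) simp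
  also have "\<dots> = inverse (1 + t * t * (X \<bullet> X))"
    using norm_factor_pos[of t X] by (simp add: exp_minus)
  finally have "exp ((- 1 / 2) * ln (1 + t * t * (X \<bullet> X))) * exp ((- 1 / 2) * ln (1 + t * t * (X \<bullet> X))) =
      inverse (1 + t * t * (X \<bullet> X))" .
  moreover have "(z + t *\<^sub>R X) \<bullet> (z + t *\<^sub>R X) = 1 + t * t * (X \<bullet> X)"
    using assms by (simp add: inner_simps inner_commute)
  ultimately show "sphere_curve z X t \<bullet> sphere_curve z X t = 1"
    using norm_factor_pos[of t X] by (simp add: sphere_curve_def mult.assoc[symmetric])
  show "(sphere_curve z X has_vector_derivative X) (at 0)"
    unfolding sphere_curve_def has_vector_derivative_def
    by (auto intro!: derivative_eq_intros simp: norm_factor_pos)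
qed

lemma smooth_on_sphere_curve: "smooth_on S (sphere_curve z X)"
  unfolding sphere_curve_def by (intro smooth_intros norm_factor_pos)

lemma tangent_S3xS3:
  assumes p: "p \<in> S3xS3"
  shows "v \<in> tangent_space S3xS3 p \<longleftrightarrow> fst p \<bullet> fst v = 0 \<and> snd p \<bullet> snd v = 0"
proof
  assume v: "v \<in> tangent_space S3xS3 p"
  have "fst p \<bullet> fst v + fst v \<bullet> fst p = 0"
    by (rule tangent_constant[OF _ p _ v, of "\<lambda>q. fst q \<bullet> fst q" _ 1])
      (auto intro!: derivative_eq_intros simp: S3xS3_iff)
  moreover have "snd p \<bullet> snd v + snd v \<bullet> snd p = 0"
    by (rule tangent_constant[OF _ p _ v, of "\<lambda>q. snd q \<bullet> snd q" _ 1])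
      (auto intro!: derivative_eq_intros simp: S3xS3_iff)
  ultimately show "fst p \<bullet> fst v = 0 \<and> snd p \<bullet> snd v = 0" by (simp add: inner_commute)
next
  assume *: "fst p \<bullet> fst v = 0 \<and> snd p \<bullet> snd v = 0"
  note c1 = sphere_curve[of "fst p" "fst v"] and c2 = sphere_curve[of "snd p" "snd v"]
  let ?\<gamma> = "\<lambda>t. (sphere_curve (fst p) (fst v) t, sphere_curve (snd p) (snd v) t)"
  have "(?\<gamma> has_vector_derivative v) (at 0)"
    using has_vector_derivative_Pair[OF c1(3) c2(3)] * p by (simp add: S3xS3_iff)
  moreover have "?\<gamma> ` {-1<..<1} \<subseteq> S3xS3" "?\<gamma> 0 = p"
    using c1 c2 * p by (auto simp: S3xS3_iff)
  moreover have "smooth_on {-1<..<1} ?\<gamma>" by (intro smooth_intros smooth_on_sphere_curve)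
  ultimately show "v \<in> tangent_space S3xS3 p"
    unfolding tangent_space_def by (intro CollectI exI[of _ ?\<gamma>] exI[of _ 1]) auto
qed

text \<open>Sign and scale are dictated by the metric. With the factor 1/2 in
  \<open>ext_deriv\<close>, the exterior derivative of this form is
  \<open>X \<bullet> cm \<i> Y\<close> in the first factor, which matches \<open>g X (phi Y)\<close>
  for the Euclidean inner product without rescaling. In return the Reeb field is -i z.\<close>

definition alpha1 :: "C2 \<times> C2 \<Rightarrow> C2 \<times> C2 \<Rightarrow> real" where
  "alpha1 p v = fst p \<bullet> cm \<i> (fst v)"

definition alpha2 :: "C2 \<times> C2 \<Rightarrow> C2 \<times> C2 \<Rightarrow> real" where
  "alpha2 p v = snd p \<bullet> cm \<i> (snd v)"

definition reeb1 :: "C2 \<times> C2 \<Rightarrow> C2 \<times> C2" where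
  "reeb1 p = (- cm \<i> (fst p), 0)"

definition reeb2 :: "C2 \<times> C2 \<Rightarrow> C2 \<times> C2" where
  "reeb2 p = (0, - cm \<i> (snd p))"

text \<open>The tangential part of multiplication by \<open>\<i>\<close>.\<close>

definition phi :: "C2 \<times> C2 \<Rightarrow> C2 \<times> C2 \<Rightarrow> C2 \<times> C2" where
  "phi p v = (cm \<i> (fst v) - alpha1 p v *\<^sub>R fst p, cm \<i> (snd v) - alpha2 p v *\<^sub>R snd p)"

lemma bounded_bilinear_alpha1: "bounded_bilinear alpha1"
  unfolding alpha1_def
  by (intro bounded_bilinear.comp[OF bounded_bilinear_inner] bounded_linear_fst
      bounded_linear_compose[OF bounded_linear_cm])

lemma bounded_bilinear_alpha2: "bounded_bilinear alpha2"
  unfolding alpha2_def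
  by (intro bounded_bilinear.comp[OF bounded_bilinear_inner] bounded_linear_snd
      bounded_linear_compose[OF bounded_linear_cm])

text \<open>Supplies the global extensions that \<open>ext_deriv\<close> needs: a constant vector is
  projected orthogonally onto all tangent spaces.\<close>

lemma ex_vector_field_S3xS3:
  assumes p: "p \<in> S3xS3" and u: "u \<in> tangent_space S3xS3 p"
  obtains X where "vector_field S3xS3 X" "X p = u"
proof
  let ?X = "\<lambda>q. (fst u - (fst q \<bullet> fst u) *\<^sub>R fst q, snd u - (snd q \<bullet> snd u) *\<^sub>R snd q)"
  show "vector_field S3xS3 ?X" unfolding vector_field_def
  proof
    show "smooth_on S3xS3 ?X" by (intro smooth_intros)
    show "\<forall>q\<in>S3xS3. ?X q \<in> tangent_space S3xS3 q"
      by (simp add: tangent_S3xS3) (simp add: S3xS3_iff inner_simps)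
  qed
  show "?X p = u" using u by (simp add: tangent_S3xS3[OF p])
qed

text \<open>General in \<open>M\<close>, since it is applied both to the product of spheres and to
  its submanifold. Multiplication by i is skew, so antisymmetrising doubles the value and cancels
  the factor 1/2.\<close>

lemma ext_deriv_alpha:
  assumes "p \<in> M" "vector_field M X" "vector_field M Y"
  shows "ext_deriv M alpha1 p (X p) (Y p) = fst (X p) \<bullet> cm \<i> (fst (Y p))"
    and "ext_deriv M alpha2 p (X p) (Y p) = snd (X p) \<bullet> cm \<i> (snd (Y p))"
proof -
  have *: "x \<bullet> cm \<i> y = - (y \<bullet> cm \<i> x)" for x y
    by (metis inner_cm_ii_left inner_commute)
  show "ext_deriv M alpha1 p (X p) (Y p) = fst (X p) \<bullet> cm \<i> (fst (Y p))"
    "ext_deriv M alpha2 p (X p) (Y p) = snd (X p) \<bullet> cm \<i> (snd (Y p))"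
    using ext_deriv_bilinear[OF bounded_bilinear_alpha1 assms(1,2) refl assms(3) refl]
      ext_deriv_bilinear[OF bounded_bilinear_alpha2 assms(1,2) refl assms(3) refl]
      *[of "fst (X p)" "fst (Y p)"] *[of "snd (X p)" "snd (Y p)"]
    by (simp_all add: alpha1_def alpha2_def)
qed

lemma ext_deriv_S3xS3:
  assumes "p \<in> S3xS3" "u \<in> tangent_space S3xS3 p" "v \<in> tangent_space S3xS3 p"
  shows "ext_deriv S3xS3 alpha1 p u v = fst u \<bullet> cm \<i> (fst v)"
    and "ext_deriv S3xS3 alpha2 p u v = snd u \<bullet> cm \<i> (snd v)"
proof -
  obtain X where X: "vector_field S3xS3 X" "X p = u" using ex_vector_field_S3xS3[OF assms(1,2)] .
  obtain Y where Y: "vector_field S3xS3 Y" "Y p = v" using ex_vector_field_S3xS3[OF assms(1,3)] .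
  show "ext_deriv S3xS3 alpha1 p u v = fst u \<bullet> cm \<i> (fst v)"
    and "ext_deriv S3xS3 alpha2 p u v = snd u \<bullet> cm \<i> (snd v)"
    using ext_deriv_alpha[OF assms(1) X(1) Y(1)] X(2) Y(2) by simp_all
qed

section \<open>Reeb fields, the endomorphism, the metric and decomposability\<close>

lemma vector_field_reeb: "vector_field S3xS3 reeb1" "vector_field S3xS3 reeb2"
proof -
  have "smooth_on S3xS3 (\<lambda>p. (cm (- \<i>) (fst p), 0::C2))" "smooth_on S3xS3 (\<lambda>p. (0::C2, cm (- \<i>) (snd p)))"
    by (intro smooth_intros smooth_on_cm)+
  then have "smooth_on S3xS3 reeb1" "smooth_on S3xS3 reeb2"
    unfolding reeb1_def[abs_def] reeb2_def[abs_def] by (simp_all add: cm_def uminus_prod_def)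
  then show "vector_field S3xS3 reeb1" "vector_field S3xS3 reeb2"
    unfolding vector_field_def by (simp_all add: tangent_S3xS3 reeb1_def reeb2_def C2_simps)
qed

lemma phi_tangent:
  assumes "p \<in> S3xS3" "v \<in> tangent_space S3xS3 p"
  shows "phi p v \<in> tangent_space S3xS3 p"
  using assms by (simp add: tangent_S3xS3) (simp add: phi_def S3xS3_iff alpha1_def alpha2_def inner_simps)

lemma reeb_fields_S3xS3: "reeb_fields S3xS3 alpha1 alpha2 reeb1 reeb2"
  unfolding reeb_fields_def
proof (intro conjI ballI vector_field_reeb)
  fix p assume p: "p \<in> S3xS3"
  then have n: "fst p \<bullet> fst p = 1" "snd p \<bullet> snd p = 1" by (simp_all add: S3xS3_iff)
  have t: "reeb1 p \<in> tangent_space S3xS3 p" "reeb2 p \<in> tangent_space S3xS3 p"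
    using vector_field_reeb p by (auto simp: vector_field_def)
  show "alpha1 p (reeb1 p) = 1" "alpha1 p (reeb2 p) = 0" "alpha2 p (reeb1 p) = 0" "alpha2 p (reeb2 p) = 1"
    using n by (simp_all add: alpha1_def alpha2_def reeb1_def reeb2_def C2_simps)
  fix v assume v: "v \<in> tangent_space S3xS3 p"
  show "ext_deriv S3xS3 alpha1 p (reeb1 p) v = 0" "ext_deriv S3xS3 alpha1 p (reeb2 p) v = 0"
    "ext_deriv S3xS3 alpha2 p (reeb1 p) v = 0" "ext_deriv S3xS3 alpha2 p (reeb2 p) v = 0"
    using v unfolding ext_deriv_S3xS3[OF p t(1) v] ext_deriv_S3xS3[OF p t(2) v] tangent_S3xS3[OF p]
    by (simp_all add: reeb1_def reeb2_def C2_simps)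
qed

lemma endomorphism_field_phi: "endomorphism_field S3xS3 phi"
  unfolding endomorphism_field_def
proof (intro conjI ballI allI impI)
  fix p assume p: "p \<in> S3xS3"
  show "linear_on_subspace (tangent_space S3xS3 p) (phi p)"
    by (simp add: linear_on_subspace_def phi_def alpha1_def alpha2_def C2_simps prod_eq_iff algebra_simps)
  show "phi p ` tangent_space S3xS3 p \<subseteq> tangent_space S3xS3 p" using phi_tangent[OF p] by auto
next
  fix X assume "vector_field S3xS3 X"
  then have "smooth_on S3xS3 X" by (simp add: vector_field_def)
  then show "smooth_on S3xS3 (\<lambda>p. phi p (X p))"
    unfolding phi_def alpha1_def alpha2_def by (intro smooth_intros smooth_on_cm)
qed

lemma riemannian_metric_S3xS3: "riemannian_metric S3xS3 (\<lambda>p. (\<bullet>))"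
  unfolding riemannian_metric_def
  by (auto simp: linear_on_subspace_def inner_simps inner_commute vector_field_def intro!: smooth_on_inner)

lemma decomposable_S3xS3: "decomposable S3xS3 alpha1 alpha2 phi"
  unfolding decomposable_def
proof (intro ballI conjI)
  fix p assume p: "p \<in> S3xS3"
  then have n: "fst p \<bullet> fst p = 1" "snd p \<bullet> snd p = 1" by (simp_all add: S3xS3_iff)
  \<comment> \<open>\<open>phi\<close> is skew for both exterior derivatives: d alpha(u, phi v) = -
    d alpha(phi u, v). Hence it maps the kernel of each of them into itself.\<close>
  have *: "fst u \<bullet> cm \<i> (fst (phi p v)) = - (fst (phi p u) \<bullet> cm \<i> (fst v))"
    "snd u \<bullet> cm \<i> (snd (phi p v)) = - (snd (phi p u) \<bullet> cm \<i> (snd v))"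
    if "u \<in> tangent_space S3xS3 p" "v \<in> tangent_space S3xS3 p" for u v
    using inner_cm_ii_left[of "fst p" "fst u"] inner_cm_ii_left[of "snd p" "snd u"]
    by (simp_all add: phi_def alpha1_def alpha2_def C2_simps inner_commute)
  show "phi p ` char_space S3xS3 alpha1 p \<subseteq> char_space S3xS3 alpha1 p"
  proof
    fix x assume "x \<in> phi p ` char_space S3xS3 alpha1 p"
    then obtain v where x: "x = phi p v" and vc: "v \<in> char_space S3xS3 alpha1 p" by blast
    then have v: "v \<in> tangent_space S3xS3 p" "alpha1 p v = 0" by (simp_all add: char_space_def)
    have ch: "fst v \<bullet> cm \<i> (fst w) = 0" if "w \<in> tangent_space S3xS3 p" for w
      using vc ext_deriv_S3xS3(1)[OF p v(1) that] that by (simp add: char_space_def)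
    show "x \<in> char_space S3xS3 alpha1 p"
      unfolding x char_space_def
    proof (intro CollectI conjI ballI)
      show "phi p v \<in> tangent_space S3xS3 p" by (rule phi_tangent[OF p v(1)])
      show "alpha1 p (phi p v) = 0"
        using v by (simp add: tangent_S3xS3[OF p]) (simp add: alpha1_def phi_def C2_simps)
      show "ext_deriv S3xS3 alpha1 p (phi p v) w = 0" if w: "w \<in> tangent_space S3xS3 p" for w
        using *[OF v(1) w] ch[OF phi_tangent[OF p w]]
        by (simp add: ext_deriv_S3xS3[OF p phi_tangent[OF p v(1)] w])
    qed
  qed
  show "phi p ` char_space S3xS3 alpha2 p \<subseteq> char_space S3xS3 alpha2 p"
  proof
    fix x assume "x \<in> phi p ` char_space S3xS3 alpha2 p"
    then obtain v where x: "x = phi p v" and vc: "v \<in> char_space S3xS3 alpha2 p" by blast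
    then have v: "v \<in> tangent_space S3xS3 p" "alpha2 p v = 0" by (simp_all add: char_space_def)
    have ch: "snd v \<bullet> cm \<i> (snd w) = 0" if "w \<in> tangent_space S3xS3 p" for w
      using vc ext_deriv_S3xS3(2)[OF p v(1) that] that by (simp add: char_space_def)
    show "x \<in> char_space S3xS3 alpha2 p"
      unfolding x char_space_def
    proof (intro CollectI conjI ballI)
      show "phi p v \<in> tangent_space S3xS3 p" by (rule phi_tangent[OF p v(1)])
      show "alpha2 p (phi p v) = 0"
        using v by (simp add: tangent_S3xS3[OF p]) (simp add: alpha2_def phi_def C2_simps)
      show "ext_deriv S3xS3 alpha2 p (phi p v) w = 0" if w: "w \<in> tangent_space S3xS3 p" for w
        using *[OF v(1) w] ch[OF phi_tangent[OF p w]]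
        by (simp add: ext_deriv_S3xS3[OF p phi_tangent[OF p v(1)] w])
    qed
  qed
qed

text \<open>The frame lists a vector for \<open>\<alpha>\<close>, a plane for
  \<open>\<omega>\<close>, a vector for \<open>\<beta>\<close> and a plane for
  \<open>\<eta>\<close>. The vanishing assumptions are triangular: each form is trivial on whatever
  involves the vectors reserved for later factors. That is exactly the assumption \<open>van\<close>
  of \<open>wedge_pos\<close>, which is applied to the three products from the inside out.\<close>

lemma volume_pos:
  assumes \<alpha>: "\<alpha> (v 0) > 0" "\<And>i. 0 < i \<Longrightarrow> i < 6 \<Longrightarrow> \<alpha> (v i) = 0"
    and \<omega>: "\<omega> (v 1) (v 2) > \<omega> (v 2) (v 1)"
      "\<And>i j. 0 < i \<Longrightarrow> i < 6 \<Longrightarrow> 0 < j \<Longrightarrow> j < 6 \<Longrightarrow> \<not> (i \<le> 2 \<and> j \<le> 2) \<Longrightarrow> \<omega> (v i) (v j) = 0"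
    and \<beta>: "\<beta> (v 3) > 0" "\<And>i. 3 < i \<Longrightarrow> i < 6 \<Longrightarrow> \<beta> (v i) = 0"
    and \<eta>: "\<eta> (v 4) (v 5) > \<eta> (v 5) (v 4)"
  shows "wedge 1 5 (as_1form \<alpha>) (wedge 2 3 (wedge_power 2 (as_2form \<omega>) 1)
    (wedge 1 2 (as_1form \<beta>) (wedge_power 2 (as_2form \<eta>) 1))) v > 0"
proof -
  have loc1: "as_1form \<gamma> v = as_1form \<gamma> w" if "\<And>i. i < 1 \<Longrightarrow> v i = w i" for \<gamma> and v w :: "nat \<Rightarrow> 'a"
    using that by (simp add: as_1form_def)
  have loc2: "wedge_power 2 (as_2form \<gamma>) 1 v = wedge_power 2 (as_2form \<gamma>) 1 w"
    if "\<And>i. i < 2 \<Longrightarrow> v i = w i" for \<gamma> and v w :: "nat \<Rightarrow> 'a"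
    using that unfolding wedge_power_2_one by simp
  have alt1: "as_1form \<gamma> (\<lambda>i. v (\<pi> i)) = of_int (sign \<pi>) * as_1form \<gamma> v" if "\<pi> permutes {..<1}"
    for \<gamma> and v :: "nat \<Rightarrow> 'a" and \<pi>
  proof -
    have "{..<1::nat} = {0}" by auto
    then show ?thesis using that by simp
  qed
  have alt2: "wedge_power 2 (as_2form \<gamma>) 1 (\<lambda>i. v (\<pi> i)) = of_int (sign \<pi>) * wedge_power 2 (as_2form \<gamma>) 1 v"
    if "\<pi> permutes {..<2}" for \<gamma> and v :: "nat \<Rightarrow> 'a" and \<pi>
    using wedge_permute[of \<pi> 2 0 "as_2form \<gamma>" "\<lambda>v. 1" v] that by simp
  let ?\<theta> = "wedge 1 2 (as_1form \<beta>) (wedge_power 2 (as_2form \<eta>) 1)"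
  let ?\<zeta> = "wedge 2 3 (wedge_power 2 (as_2form \<omega>) 1) ?\<theta>"
  have three: "1 + 2 = (3::nat)" "2 + 3 = (5::nat)" by simp_all
  have loc3: "?\<theta> v = ?\<theta> w" if "\<And>i. i < 3 \<Longrightarrow> v i = w i" for v w
    by (rule wedge_cong[OF loc1 loc2]) (use that in auto)
  have loc5: "?\<zeta> v = ?\<zeta> w" if "\<And>i. i < 5 \<Longrightarrow> v i = w i" for v w
    by (rule wedge_cong[OF loc2 loc3]) (use that in auto)
  have alt3: "?\<theta> (\<lambda>i. v (\<pi> i)) = of_int (sign \<pi>) * ?\<theta> v" if "\<pi> permutes {..<3}" for v \<pi>
    by (rule wedge_permute) (use that in \<open>simp only: three\<close>)
  have alt5: "?\<zeta> (\<lambda>i. v (\<pi> i)) = of_int (sign \<pi>) * ?\<zeta> v" if "\<pi> permutes {..<5}" for v \<pi>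
    by (rule wedge_permute) (use that in \<open>simp only: three\<close>)
  have lt: "\<sigma> i < n" if "\<sigma> permutes {..<n}" "i < n" for \<sigma> and i n :: nat
    using permutes_in_image[OF that(1), of i] that(2) by simp
  \<comment> \<open>The arguments seen by the inner products: \<open>u\<close> drops the vector used
    by \<open>\<alpha>\<close>, and \<open>t\<close> also drops the two used by
    \<open>\<omega>\<close>.\<close>
  define u where "u i = v (1 + i)" for i
  define t where "t i = u (2 + i)" for i
  have vals: "u 0 = v 1" "u 1 = v 2" "t 0 = v 3" "t (1 + 0) = v 4" "t (1 + 1) = v 5"
    by (simp_all add: u_def t_def numeral_eq_Suc)
  have 3: "?\<theta> t > 0"
  proof (rule wedge_pos)
    fix \<sigma> :: "nat \<Rightarrow> nat" assume p: "\<sigma> permutes {..<1 + 2}" and ne: "as_1form \<beta> (\<lambda>i. t (\<sigma> i)) \<noteq> 0"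
    have "\<sigma> 0 < 3" using lt[OF p, of 0] by simp
    then have "\<sigma> 0 = 0" using ne \<beta>(2)[of "3 + \<sigma> 0"] by (auto simp: as_1form_def t_def u_def numeral_3_eq_3)
    then show "\<sigma> ` {..<1} \<subseteq> {..<1}" by auto
  next
    show "as_1form \<beta> t > 0" using \<beta> vals by (simp add: as_1form_def)
    show "wedge_power 2 (as_2form \<eta>) 1 (\<lambda>i. t (1 + i)) > 0"
      unfolding wedge_power_2_one using \<eta> by (simp only: vals) simp
  qed (rule alt1 loc1 loc2 alt2[of _ _ "\<lambda>i. t (1 + i)"]; assumption)+
  have 5: "?\<zeta> u > 0"
  proof (rule wedge_pos)
    fix \<sigma> :: "nat \<Rightarrow> nat" assume \<sigma>: "\<sigma> permutes {..<2 + 3}"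
      and ne: "wedge_power 2 (as_2form \<omega>) 1 (\<lambda>i. u (\<sigma> i)) \<noteq> 0"
    have l: "\<sigma> 0 < 5" "\<sigma> 1 < 5" using \<sigma> lt[of \<sigma> 5 0] lt[of \<sigma> 5 1] by simp_all
    have "\<sigma> 0 \<le> 1 \<and> \<sigma> 1 \<le> 1"
    proof (rule ccontr)
      assume "\<not> ?thesis"
      then have "\<omega> (u (\<sigma> 0)) (u (\<sigma> 1)) = 0" "\<omega> (u (\<sigma> 1)) (u (\<sigma> 0)) = 0"
        using l unfolding u_def by (auto intro!: \<omega>(2))
      then show False using ne unfolding wedge_power_2_one by simp
    qed
    then show "\<sigma> ` {..<2} \<subseteq> {..<2}" by (auto simp: less_2_cases_iff)
  next
    show "wedge_power 2 (as_2form \<omega>) 1 u > 0" unfolding wedge_power_2_one vals using \<omega>(1) by simp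
    show "?\<theta> (\<lambda>i. u (2 + i)) > 0" using 3 unfolding t_def .
  qed (rule alt2 loc2 loc3 alt3[of _ "\<lambda>i. u (2 + i)"]; assumption)+
  show ?thesis
  proof (rule wedge_pos)
    fix \<sigma> :: "nat \<Rightarrow> nat" assume "\<sigma> permutes {..<1 + 5}" and ne: "as_1form \<alpha> (\<lambda>i. v (\<sigma> i)) \<noteq> 0"
    then have "\<sigma> 0 < 6" using lt[of \<sigma> 6 0] by simp
    then have "\<sigma> 0 = 0" using ne \<alpha>(2)[of "\<sigma> 0"] by (auto simp: as_1form_def)
    then show "\<sigma> ` {..<1} \<subseteq> {..<1}" by auto
  next
    show "as_1form \<alpha> v > 0" using \<alpha> by (simp add: as_1form_def)
    show "?\<zeta> (\<lambda>i. v (1 + i)) > 0" using 5 unfolding u_def .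
  qed (rule alt1 loc1 loc5 alt5[of _ "\<lambda>i. v (1 + i)"]; assumption)+
qed

text \<open>Lagrange's identity for the Hermitian product \<open>H\<close>. If X and Y are
  real-orthogonal to z, then \<open>H X z\<close> and \<open>H z Y\<close> are imaginary and their
  product is real, so the imaginary part of \<open>H X Y\<close> comes from the determinants
  \<open>\<xi>\<close> alone. This is the decomposable shape required by
  \<open>wedge_power_2_two_eq_0\<close>.\<close>

lemma rank_two:
  assumes z: "z \<bullet> z = 1" and X: "z \<bullet> X = 0" and Y: "z \<bullet> Y = 0"
  defines "\<xi> \<equiv> \<lambda>X. fst z * snd X - snd z * fst X"
  shows "X \<bullet> cm \<i> Y = Im (\<xi> X) * Re (\<xi> Y) - Re (\<xi> X) * Im (\<xi> Y)"
proof -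
  define H where "H x y = fst x * cnj (fst y) + snd x * cnj (snd y)" for x y :: C2
  have "H X Y * H z z = H X z * H z Y + \<xi> X * cnj (\<xi> Y)"
    by (simp add: H_def \<xi>_def algebra_simps)
  moreover have "H z z = 1"
    using z by (simp add: H_def complex_eq_iff inner_prod_def inner_complex_def)
  ultimately have "Im (H X Y) = Im (H X z * H z Y) + Im (\<xi> X * cnj (\<xi> Y))" by simp
  moreover have "Re (H X z) = 0" "Re (H z Y) = 0" "Im (H X Y) = X \<bullet> cm \<i> Y"
    using X Y by (simp_all add: H_def cm_def inner_prod_def inner_complex_def algebra_simps)
  ultimately show ?thesis by simp
qed

text \<open>Left multiplication by the quaternion j. Over the reals, \<open>jq z\<close> and i times
  it span the contact plane at a unit vector z.\<close>

definition jq :: "C2 \<Rightarrow> C2" where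
  "jq z = (- cnj (snd z), cnj (fst z))"

lemma jq: "z \<bullet> jq z = 0" "z \<bullet> cm \<i> (jq z) = 0" "jq z \<bullet> jq z = z \<bullet> z"
  by (simp_all add: jq_def cm_def inner_prod_def inner_complex_def algebra_simps)

lemma contact_pair_S3xS3:
  assumes "manifold 6 S3xS3"
  shows "contact_pair 6 S3xS3 1 1 alpha1 alpha2"
  unfolding contact_pair_def
proof (intro conjI ballI allI impI assms one_form_bilinear bounded_bilinear_alpha1 bounded_bilinear_alpha2)
  fix p assume p: "p \<in> S3xS3"
  then have n: "fst p \<bullet> fst p = 1" "snd p \<bullet> snd p = 1" by (simp_all add: S3xS3_iff)
  \<comment> \<open>In each factor: the Reeb vector, then a basis of the contact plane. The order, i
    \<open>jq\<close> before \<open>jq\<close>, makes the exterior derivative take the value +1 on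
    the plane.\<close>
  let ?v = "\<lambda>i::nat. [reeb1 p, (cm \<i> (jq (fst p)), 0), (jq (fst p), 0),
    reeb2 p, (0, cm \<i> (jq (snd p))), (0, jq (snd p))] ! i"
  have six: "i < 6 \<longleftrightarrow> i \<in> {0, 1, 2, 3, 4, 5}" for i :: nat by (simp only: insert_iff empty_iff) arith
  have ball: "(\<forall>i<6. P i) \<longleftrightarrow> P 0 \<and> P 1 \<and> P 2 \<and> P 3 \<and> P 4 \<and> P (5::nat)" for P
    unfolding six Ball_def[symmetric] by (simp only: ball_simps simp_thms)
  have t: "\<forall>i<6. ?v i \<in> tangent_space S3xS3 p"
    unfolding ball using n by (simp add: tangent_S3xS3[OF p] reeb1_def reeb2_def C2_simps jq)
  have a: "\<forall>i<6. 0 < i \<longrightarrow> alpha1 p (?v i) = 0" "\<forall>i<6. 3 < i \<longrightarrow> alpha2 p (?v i) = 0"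
    unfolding ball using n by (simp_all add: alpha1_def alpha2_def reeb2_def C2_simps jq)
  have d: "ext_deriv S3xS3 alpha1 p (?v i) (?v j) = fst (?v i) \<bullet> cm \<i> (fst (?v j))"
    "ext_deriv S3xS3 alpha2 p (?v i) (?v j) = snd (?v i) \<bullet> cm \<i> (snd (?v j))"
    if "i < 6" "j < 6" for i j
    using ext_deriv_S3xS3[OF p] t that by blast+
  have f: "\<forall>i<6. 2 < i \<longrightarrow> fst (?v i) = 0"
    unfolding ball by (simp add: reeb2_def)
  have "wedge 1 5 (as_1form (alpha1 p)) (wedge 2 3 (wedge_power 2 (as_2form (ext_deriv S3xS3 alpha1 p)) 1)
    (wedge 1 2 (as_1form (alpha2 p)) (wedge_power 2 (as_2form (ext_deriv S3xS3 alpha2 p)) 1))) ?v > 0"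
  proof (rule volume_pos)
    show "ext_deriv S3xS3 alpha1 p (?v i) (?v j) = 0"
      if "0 < i" "i < 6" "0 < j" "j < 6" "\<not> (i \<le> 2 \<and> j \<le> 2)" for i j
    proof -
      have "fst (?v i) = 0 \<or> fst (?v j) = 0" using f that by (auto simp: not_le)
      then show ?thesis using d(1)[OF that(2,4)] by (auto simp: cm_zero)
    qed
    show "ext_deriv S3xS3 alpha1 p (?v 2) (?v 1) < ext_deriv S3xS3 alpha1 p (?v 1) (?v 2)"
      using n d(1)[of 1 2] d(1)[of 2 1] by (simp add: C2_simps jq)
    show "ext_deriv S3xS3 alpha2 p (?v 5) (?v 4) < ext_deriv S3xS3 alpha2 p (?v 4) (?v 5)"
      using n d(2)[of 4 5] d(2)[of 5 4] by (simp add: C2_simps jq)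
  qed (use a n in \<open>auto simp: alpha1_def alpha2_def reeb1_def reeb2_def C2_simps jq\<close>)
  then show "\<exists>v. (\<forall>i<6. v i \<in> tangent_space S3xS3 p) \<and>
      wedge 1 (2 * 1 + (1 + 2 * 1)) (as_1form (alpha1 p))
        (wedge (2 * 1) (1 + 2 * 1) (wedge_power 2 (as_2form (ext_deriv S3xS3 alpha1 p)) 1)
          (wedge 1 (2 * 1) (as_1form (alpha2 p))
            (wedge_power 2 (as_2form (ext_deriv S3xS3 alpha2 p)) 1))) v \<noteq> 0"
    using t by (intro exI[of _ ?v]) (simp del: wedge_power.simps One_nat_def)
next
  fix p and v :: "nat \<Rightarrow> C2 \<times> C2"
  assume p: "p \<in> S3xS3" and v: "\<forall>i<2 * (1 + 1). v i \<in> tangent_space S3xS3 p"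
  then have n: "fst p \<bullet> fst p = 1" "snd p \<bullet> snd p = 1" by (simp_all add: S3xS3_iff)
  have v: "v i \<in> tangent_space S3xS3 p" if "i < 4" for i using v that by simp
  have two: "1 + 1 = (2::nat)" by simp
  show "wedge_power 2 (as_2form (ext_deriv S3xS3 alpha1 p)) (1 + 1) v = 0" unfolding two
    by (rule wedge_power_2_two_eq_0)
      (simp add: ext_deriv_S3xS3[OF p v v], rule rank_two[OF n(1)]; use v tangent_S3xS3[OF p] in blast)
  show "wedge_power 2 (as_2form (ext_deriv S3xS3 alpha2 p)) (1 + 1) v = 0" unfolding two
    by (rule wedge_power_2_two_eq_0)
      (simp add: ext_deriv_S3xS3[OF p v v], rule rank_two[OF n(2)]; use v tangent_S3xS3[OF p] in blast)
qed simp

lemma metric_contact_pair_S3xS3: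
  assumes "manifold 6 S3xS3"
  shows "metric_contact_pair 6 S3xS3 1 1 alpha1 alpha2 reeb1 reeb2 phi (\<lambda>p. (\<bullet>))"
  unfolding metric_contact_pair_def
proof (intro conjI ballI contact_pair_S3xS3 assms reeb_fields_S3xS3 endomorphism_field_phi
    riemannian_metric_S3xS3)
  fix p assume p: "p \<in> S3xS3"
  then have n: "fst p \<bullet> fst p = 1" "snd p \<bullet> snd p = 1" by (simp_all add: S3xS3_iff)
  show "phi p (reeb1 p) = 0" "phi p (reeb2 p) = 0"
    using n by (simp_all add: phi_def reeb1_def reeb2_def alpha1_def alpha2_def C2_simps prod_eq_iff)
  fix u assume u: "u \<in> tangent_space S3xS3 p"
  then have u': "fst p \<bullet> fst u = 0" "snd p \<bullet> snd u = 0" by (simp_all add: tangent_S3xS3[OF p])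
  show "phi p (phi p u) = - u + alpha1 p u *\<^sub>R reeb1 p + alpha2 p u *\<^sub>R reeb2 p"
    using u' by (simp add: phi_def reeb1_def reeb2_def alpha1_def alpha2_def C2_simps prod_eq_iff)
  show "u \<bullet> reeb1 p = alpha1 p u" "u \<bullet> reeb2 p = alpha2 p u"
    using inner_cm_ii_left[of "fst p" "fst u"] inner_cm_ii_left[of "snd p" "snd u"]
    by (simp_all add: inner_prod_def reeb1_def reeb2_def alpha1_def alpha2_def inner_commute)
  fix v assume v: "v \<in> tangent_space S3xS3 p"
  show "u \<bullet> phi p v = ext_deriv S3xS3 alpha1 p u v + ext_deriv S3xS3 alpha2 p u v"
    using u' by (simp add: ext_deriv_S3xS3[OF p u v] inner_prod_def[of u] phi_def inner_simps inner_commute)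
qed

section \<open>Holomorphic charts\<close>

text \<open>Multiplication by i followed by the projection to the tangent space along the orbits of
  the action (exp(t) z, exp(s i t) w). The orbit direction belonging to \<beta> is (\<beta> z, s i
  \<beta> w). Tangency to the two spheres requires Re \<beta> = alpha1 and Re (s i \<beta>) = - s Im
  \<beta> = alpha2, which determines \<beta> when s^2 = 1.\<close>

definition complex_structure :: "real \<Rightarrow> C2 \<times> C2 \<Rightarrow> C2 \<times> C2 \<Rightarrow> C2 \<times> C2" where
  "complex_structure s p v = (let \<beta> = Complex (alpha1 p v) (- s * alpha2 p v)
     in (cm \<i> (fst v) - cm \<beta> (fst p), cm \<i> (snd v) - cm (s * \<i> * \<beta>) (snd p)))"

lemma J_structure_eq: "J_structure alpha1 alpha2 reeb1 reeb2 phi = complex_structure 1"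
  by (intro ext, simp only: J_structure_def phi_def reeb1_def reeb2_def complex_structure_def Let_def
      cm_conv[of "Complex _ _"] cm_conv[of "_ * Complex _ _"]) (simp add: prod_eq_iff)

lemma T_structure_eq: "T_structure alpha1 alpha2 reeb1 reeb2 phi = complex_structure (- 1)"
  by (intro ext, simp only: T_structure_def phi_def reeb1_def reeb2_def complex_structure_def Let_def
      cm_conv[of "Complex _ _"] cm_conv[of "_ * Complex _ _"]) (simp add: prod_eq_iff)

text \<open>The complex expression suits the charts; this real one suits inner products with the
  point.\<close>

lemma complex_structure_alt:
  "complex_structure s p v = (cm \<i> (fst v) - alpha1 p v *\<^sub>R fst p + (s * alpha2 p v) *\<^sub>R cm \<i> (fst p),
     cm \<i> (snd v) - (s * s * alpha2 p v) *\<^sub>R snd p - (s * alpha1 p v) *\<^sub>R cm \<i> (snd p))"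
  by (simp only: complex_structure_def Let_def cm_conv[of "Complex _ _"] cm_conv[of "_ * Complex _ _"])
    (simp add: prod_eq_iff)

lemma complex_structure_tangent:
  assumes s: "s * s = 1" and p: "p \<in> S3xS3" and v: "v \<in> tangent_space S3xS3 p"
  shows "complex_structure s p v \<in> tangent_space S3xS3 p"
  using v p by (simp add: tangent_S3xS3[OF p] complex_structure_alt s)
    (simp add: S3xS3_iff alpha1_def alpha2_def C2_simps)

lemma complex_structure_complex_structure:
  assumes s: "s * s = 1" and p: "p \<in> S3xS3" and v: "v \<in> tangent_space S3xS3 p"
  shows "complex_structure s p (complex_structure s p v) = - v"
proof -
  have n: "fst p \<bullet> fst p = 1" "snd p \<bullet> snd p = 1" using p by (simp_all add: S3xS3_iff)
  have t: "fst p \<bullet> fst v = 0" "snd p \<bullet> snd v = 0" using v by (simp_all add: tangent_S3xS3[OF p])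
  have "alpha1 p (complex_structure s p v) = - s * alpha2 p v" "alpha2 p (complex_structure s p v) = s * alpha1 p v"
    using n t by (simp_all add: alpha1_def alpha2_def complex_structure_alt C2_simps)
  then show ?thesis
    using s by (simp add: complex_structure_alt[of _ _ "complex_structure s p v"]) (simp add: complex_structure_alt C2_simps prod_eq_iff algebra_simps)
qed

lemma almost_complex_complex_structure:
  assumes s: "s * s = 1"
  shows "almost_complex S3xS3 (complex_structure s)"
  unfolding almost_complex_def endomorphism_field_def
proof (intro conjI ballI allI impI)
  fix p assume p: "p \<in> S3xS3"
  show "linear_on_subspace (tangent_space S3xS3 p) (complex_structure s p)"
    by (simp add: linear_on_subspace_def complex_structure_alt alpha1_def alpha2_def C2_simps prod_eq_iff algebra_simps)
  show "complex_structure s p ` tangent_space S3xS3 p \<subseteq> tangent_space S3xS3 p" using complex_structure_tangent[OF s p] by auto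
next
  fix X assume "vector_field S3xS3 X"
  then have "smooth_on S3xS3 X" by (simp add: vector_field_def)
  then show "smooth_on S3xS3 (\<lambda>p. complex_structure s p (X p))"
    unfolding complex_structure_alt alpha1_def alpha2_def by (intro smooth_intros smooth_on_cm)
qed (rule complex_structure_complex_structure[OF s])

text \<open>The fourth coordinate is padding: the ambient space has four complex dimensions and the
  product of spheres needs three.\<close>

definition chart :: "real \<Rightarrow> C2 \<times> C2 \<Rightarrow> C2 \<times> C2" where
  "chart s q = ((snd (fst q) / fst (fst q), snd (snd q) / fst (snd q)),
     (Ln (fst (fst q)) + s * \<i> * Ln (fst (snd q)), 0))"

text \<open>The right half-planes keep both first coordinates away from 0 and from the branch cut of
  \<open>Ln\<close>.\<close>

definition chart_domain :: "(C2 \<times> C2) set" where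
  "chart_domain = {q. Re (fst (fst q)) > 0 \<and> Re (fst (snd q)) > 0}"

text \<open>The logarithm of the modulus of x1, for a unit vector (x1, x2) with x2 = u x1, because
  then |x1|^2 (1 + |u|^2) = 1.\<close>

definition half_log :: "complex \<Rightarrow> real" where
  "half_log u = (- 1 / 2) * ln (1 + u \<bullet> u)"

text \<open>\<open>arg1\<close> and \<open>arg2\<close> recover the arguments of z1 and w1 from the
  third coordinate log z1 + s i log w1. Its real part is log |z1| - s arg w1 and its imaginary part
  is arg z1 + s log |w1|; the moduli are known through \<open>half_log\<close>, and 1/s = s.\<close>

definition arg1 :: "real \<Rightarrow> C2 \<times> C2 \<Rightarrow> real" where
  "arg1 s x = Im (fst (snd x)) - s * half_log (snd (fst x))"

definition arg2 :: "real \<Rightarrow> C2 \<times> C2 \<Rightarrow> real" where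
  "arg2 s x = s * (half_log (fst (fst x)) - Re (fst (snd x)))"

definition chart_inv :: "real \<Rightarrow> C2 \<times> C2 \<Rightarrow> C2 \<times> C2" where
  "chart_inv s x =
    (cm (exp (of_real (half_log (fst (fst x))) + \<i> * of_real (arg1 s x))) (1, fst (fst x)),
     cm (exp (of_real (half_log (snd (fst x))) + \<i> * of_real (arg2 s x))) (1, snd (fst x)))"

definition chart_image :: "real \<Rightarrow> (C2 \<times> C2) set" where
  "chart_image s = {x. snd (snd x) = 0 \<and> \<bar>arg1 s x\<bar> < pi / 2 \<and> \<bar>arg2 s x\<bar> < pi / 2}"

lemma inner_self_pos: "(0::real) < 1 + u \<bullet> u"
  by (simp add: add_pos_nonneg)

lemma smooth_on_half_log: "smooth_on S f \<Longrightarrow> smooth_on S (\<lambda>x. half_log (f x))"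
  unfolding half_log_def by (intro smooth_intros inner_self_pos)

lemma smooth_on_chart: "smooth_on chart_domain (chart s)"
  unfolding chart_def by (intro smooth_intros) (auto simp: chart_domain_def)

lemma smooth_on_chart_inv: "smooth_on S (chart_inv s)"
  unfolding chart_inv_def arg1_def arg2_def by (intro smooth_intros smooth_on_cm smooth_on_half_log)

lemma open_chart_domain: "open chart_domain"
  unfolding chart_domain_def by (intro open_Collect_conj open_Collect_less continuous_intros)

lemma exp_half_log: "norm (exp (of_real (half_log u) + \<i> * of_real t)) ^ 2 * (1 + u \<bullet> u) = 1"
proof -
  have "norm (exp (of_real (half_log u) + \<i> * of_real t)) ^ 2 = exp (2 * half_log u)"
    by (simp add: exp_double[symmetric])
  also have "\<dots> = inverse (1 + u \<bullet> u)"
    using inner_self_pos[of u] by (simp add: half_log_def exp_minus)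
  finally show ?thesis using inner_self_pos[of u] by simp
qed

lemma chart_inv_in_S3xS3: "chart_inv s x \<in> S3xS3"
proof -
  have "cm c (1, u) \<bullet> cm c (1, u) = norm c ^ 2 * (1 + u \<bullet> u)" for c u
    unfolding power2_norm_eq_inner[symmetric] norm_cm power_mult_distrib
    by (simp add: norm_prod_def)
  then show ?thesis unfolding S3xS3_iff chart_inv_def fst_conv snd_conv by (simp only: exp_half_log)
qed

lemma Re_exp_pos: "\<bar>t\<bar> < pi / 2 \<Longrightarrow> Re (exp (of_real r + \<i> * of_real t)) > 0"
  by (simp add: Re_exp cos_gt_zero_pi)

lemma chart_inv_in_domain: "x \<in> chart_image s \<Longrightarrow> chart_inv s x \<in> chart_domain"
  by (simp add: chart_image_def chart_domain_def chart_inv_def cm_def Re_exp_pos)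

lemma chart_chart_inv:
  assumes s: "s * s = 1" and x: "x \<in> chart_image s"
  shows "chart s (chart_inv s x) = x"
proof -
  have l: "Ln (exp (of_real r + \<i> * of_real t)) = of_real r + \<i> * of_real t" if "\<bar>t\<bar> < pi / 2" for r t
    by (rule Ln_exp) (use that in auto)
  obtain u v t where x_eq: "x = ((u, v), (t, 0))"
    using x by (cases x) (auto simp: chart_image_def)
  have "s * arg2 s x = half_log u - Re t" "arg1 s x = Im t - s * half_log v"
    by (simp_all add: arg1_def arg2_def s mult.assoc[symmetric] x_eq)
  then have "of_real (half_log u) + \<i> * of_real (arg1 s x) +
      s * \<i> * (of_real (half_log v) + \<i> * of_real (arg2 s x)) = t"
    by (simp add: complex_eq_iff)
  moreover have "chart s (chart_inv s x) =
      ((u, v), (Ln (exp (of_real (half_log u) + \<i> * of_real (arg1 s x))) +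
        s * \<i> * Ln (exp (of_real (half_log v) + \<i> * of_real (arg2 s x))), 0))"
    by (simp add: chart_def chart_inv_def cm_def x_eq del: Ln_exp)
  ultimately show ?thesis
    using x by (simp only: l chart_image_def mem_Collect_eq) (simp only: x_eq)
qed

lemma half_log_eq:
  assumes "(x1, x2) \<bullet> (x1, x2) = 1" "x1 \<noteq> 0"
  shows "half_log (x2 / x1) = Re (Ln x1)"
proof -
  have "1 + (x2 / x1) \<bullet> (x2 / x1) = inverse (norm x1 ^ 2)"
  proof -
    have "norm x1 ^ 2 + norm x2 ^ 2 = 1" using assms(1) by (simp add: power2_norm_eq_inner)
    then show ?thesis using assms(2)
      by (simp add: power2_norm_eq_inner[symmetric] norm_divide power_divide field_simps)
  qed
  then show ?thesis using assms(2)
    by (simp add: half_log_def ln_inverse ln_realpow)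
qed

lemma chart_inv_chart:
  assumes s: "s * s = 1" and q: "q \<in> S3xS3" "q \<in> chart_domain"
  shows "chart_inv s (chart s q) = q" "chart s q \<in> chart_image s"
proof -
  obtain x1 x2 y1 y2 where q_eq: "q = ((x1, x2), (y1, y2))" by (metis surj_pair)
  have r: "Re x1 > 0" "Re y1 > 0" using q(2) by (simp_all add: q_eq chart_domain_def)
  then have ne: "x1 \<noteq> 0" "y1 \<noteq> 0" by auto
  have h: "half_log (x2 / x1) = Re (Ln x1)" "half_log (y2 / y1) = Re (Ln y1)"
    by (rule half_log_eq; use q(1) ne in \<open>simp add: q_eq S3xS3_iff\<close>)+
  have a1: "arg1 s (chart s q) = Im (Ln x1)" using h by (simp add: arg1_def chart_def q_eq)
  have "arg2 s (chart s q) = (s * s) * Im (Ln y1)"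
    using h by (simp add: arg2_def chart_def q_eq algebra_simps)
  then have a2: "arg2 s (chart s q) = Im (Ln y1)" using s by simp
  show "chart s q \<in> chart_image s"
    unfolding chart_image_def using a1 a2 r Re_Ln_pos_lt_imp by (simp add: chart_def)
  have "of_real (Re z) + \<i> * of_real (Im z) = z" for z by (simp add: complex_eq_iff)
  then have "exp (of_real (half_log (x2 / x1)) + \<i> * of_real (Im (Ln x1))) = x1"
    "exp (of_real (half_log (y2 / y1)) + \<i> * of_real (Im (Ln y1))) = y1"
    unfolding h using exp_Ln ne by metis+
  moreover have "fst (chart s q) = (x2 / x1, y2 / y1)" by (simp add: chart_def q_eq)
  ultimately show "chart_inv s (chart s q) = q"
    unfolding chart_inv_def a1 a2 using ne by (simp add: q_eq cm_def)
qed

lemma diffeo_chart: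
  assumes s: "s * s = 1"
  shows "diffeo (S3xS3 \<inter> chart_domain) (chart_image s) (chart s)"
  unfolding diffeo_def
proof (intro exI[of _ "chart_inv s"] conjI)
  show "smooth_on (S3xS3 \<inter> chart_domain) (chart s)"
    by (rule smooth_on_subset[OF smooth_on_chart]) auto
  show "smooth_on (chart_image s) (chart_inv s)" by (rule smooth_on_chart_inv)
  show "chart s ` (S3xS3 \<inter> chart_domain) = chart_image s"
    using chart_inv_chart(2)[OF s] chart_chart_inv[OF s] chart_inv_in_S3xS3 chart_inv_in_domain
    by (auto simp: image_iff) (metis IntI)
  show "chart_inv s ` chart_image s = S3xS3 \<inter> chart_domain"
    using chart_inv_chart[OF s] chart_inv_in_S3xS3 chart_inv_in_domain
    by (auto simp: image_iff) (metis)
qed (use chart_inv_chart[OF s] chart_chart_inv[OF s] in auto)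

section \<open>The differential of the chart and its complex linearity\<close>

definition chart_deriv :: "real \<Rightarrow> C2 \<times> C2 \<Rightarrow> C2 \<times> C2 \<Rightarrow> C2 \<times> C2" where
  "chart_deriv s q v =
    ((snd (fst v) / fst (fst q) - snd (fst q) * fst (fst v) / fst (fst q) ^ 2,
      snd (snd v) / fst (snd q) - snd (snd q) * fst (snd v) / fst (snd q) ^ 2),
     (fst (fst v) / fst (fst q) + s * \<i> * (fst (snd v) / fst (snd q)), 0))"

lemma chart_has_derivative:
  assumes "q \<in> chart_domain"
  shows "(chart s has_derivative chart_deriv s q) (at q)"
proof -
  have r: "Re (fst (fst q)) > 0" "Re (fst (snd q)) > 0" using assms by (auto simp: chart_domain_def)
  then have ne: "fst (fst q) \<noteq> 0" "fst (snd q) \<noteq> 0"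
    and np: "fst (fst q) \<notin> \<real>\<^sub>\<le>\<^sub>0" "fst (snd q) \<notin> \<real>\<^sub>\<le>\<^sub>0"
    by (auto simp: complex_nonpos_Reals_iff)
  have L: "((\<lambda>q. Ln (f q)) has_derivative (\<lambda>v. f v / f q)) (at q)"
    if "bounded_linear f" "f q \<notin> \<real>\<^sub>\<le>\<^sub>0" for f :: "C2 \<times> C2 \<Rightarrow> complex"
    using has_derivative_compose[OF bounded_linear_imp_has_derivative[OF that(1), of "at q"]
        has_field_derivative_Ln[OF that(2), unfolded has_field_derivative_def]]
    by (simp add: divide_inverse mult.commute)
  note L1 = L[OF bounded_linear_compose[OF bounded_linear_fst bounded_linear_fst] np(1)]
    and L2 = L[OF bounded_linear_compose[OF bounded_linear_fst bounded_linear_snd] np(2)]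
  show ?thesis
    unfolding chart_def chart_deriv_def[abs_def]
    by (auto intro!: derivative_eq_intros L1 L2 simp: ne divide_simps power2_eq_square)
qed

text \<open>The chart differential does not see the terms with \<open>\<beta>\<close>, by which \<open>complex_structure\<close> differs from
  multiplication by \<open>\<i>\<close>.\<close>

lemma chart_deriv_complex_linear:
  assumes s: "s * s = 1" and q: "q \<in> chart_domain"
  shows "chart_deriv s q (cm \<i> X - cm \<beta> (fst q), cm \<i> Y - cm (s * \<i> * \<beta>) (snd q)) =
    (cm \<i> (fst (chart_deriv s q (X, Y))), cm \<i> (snd (chart_deriv s q (X, Y))))"
proof -
  have ne: "fst (fst q) \<noteq> 0" "fst (snd q) \<noteq> 0" using q by (auto simp: chart_domain_def)
  have "complex_of_real s * complex_of_real s = 1" using s by (metis of_real_1 of_real_mult)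
  then have s2: "complex_of_real s * (complex_of_real s * c) = c" for c by (metis mult.assoc mult_1)
  show ?thesis
    unfolding chart_deriv_def cm_def using ne
    by (simp add: prod_eq_iff field_simps power2_eq_square s2)
qed

section \<open>Unitary coordinate changes\<close>

definition unitary :: "(C2 \<Rightarrow> C2) \<Rightarrow> (C2 \<Rightarrow> C2) \<Rightarrow> bool" where
  "unitary A A' \<longleftrightarrow> bounded_linear A \<and> bounded_linear A' \<and> (\<forall>c x. A (cm c x) = cm c (A x)) \<and>
     (\<forall>x. norm (A x) = norm x) \<and> (\<forall>x. A (A' x) = x) \<and> (\<forall>x. A' (A x) = x)"

text \<open>The element of SU(2) that takes the unit vector a to (1,0): its components are the
  Hermitian product of x with a and the determinant of a and x.\<close>

definition rot :: "C2 \<Rightarrow> C2 \<Rightarrow> C2" where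
  "rot a x = (cnj (fst a) * fst x + cnj (snd a) * snd x, fst a * snd x - snd a * fst x)"

definition rot_inv :: "C2 \<Rightarrow> C2 \<Rightarrow> C2" where
  "rot_inv a y = (fst a * fst y - cnj (snd a) * snd y, snd a * fst y + cnj (fst a) * snd y)"

lemma unit_cnj:
  assumes "a \<bullet> a = (1::real)"
  shows "fst a * cnj (fst a) + snd a * cnj (snd a) = 1"
  using assms by (simp add: complex_eq_iff inner_prod_def inner_complex_def)

lemma unitary_rot:
  assumes a: "a \<bullet> a = (1::real)"
  shows "unitary (rot a) (rot_inv a)"
  unfolding unitary_def
proof (intro conjI allI)
  note u = unit_cnj[OF a]
  show "bounded_linear (rot a)" "bounded_linear (rot_inv a)"
    unfolding rot_def rot_inv_def
    by (intro bounded_linear_Pair bounded_linear_add bounded_linear_sub bounded_linear_mult_right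
        bounded_linear_compose[OF bounded_linear_mult_right] bounded_linear_fst bounded_linear_snd)+
  fix x :: C2
  show "rot a (cm c x) = cm c (rot a x)" for c by (simp add: rot_def cm_def algebra_simps)
  have e: "fst a * cnj (fst a) = 1 - snd a * cnj (snd a)" using u by (simp add: algebra_simps)
  have "rot a (rot_inv a x) = cm (fst a * cnj (fst a) + snd a * cnj (snd a)) x"
    "rot_inv a (rot a x) = cm (fst a * cnj (fst a) + snd a * cnj (snd a)) x"
    by (simp_all add: rot_def rot_inv_def cm_def algebra_simps)
  then show "rot a (rot_inv a x) = x" "rot_inv a (rot a x) = x" by (simp_all add: u cm_1)
  have "rot a x \<bullet> rot a x = (a \<bullet> a) * (x \<bullet> x)"
    by (simp add: rot_def inner_prod_def inner_complex_def algebra_simps)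
  then show "norm (rot a x) = norm x" using a by (simp add: norm_eq)
qed

lemma rot_self: "a \<bullet> a = (1::real) \<Longrightarrow> rot a a = (1, 0)"
  using unit_cnj[of a] by (simp add: rot_def mult.commute)

text \<open>The extra phase is what brings both components of a point (z, cz) to (1,0) with
  essentially the same rotation.\<close>

lemma unitary_cm:
  assumes A: "unitary A A'" and \<kappa>: "norm \<kappa> = 1"
  shows "unitary (\<lambda>x. cm \<kappa> (A x)) (\<lambda>x. A' (cm (inverse \<kappa>) x))"
proof -
  have "\<kappa> \<noteq> 0" using \<kappa> by auto
  then show ?thesis
    using A \<kappa> unfolding unitary_def
    by (intro conjI allI bounded_linear_compose[OF bounded_linear_cm] bounded_linear_compose[OF _ bounded_linear_cm])
      (simp_all add: cm_cm mult.commute norm_cm cm_1 del: split_paired_All)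
qed

lemma diffeo_compose_linear:
  assumes f: "diffeo (M \<inter> W) B f" and L: "bounded_linear L" "bounded_linear L'"
    and inv: "\<And>x. L (L' x) = x" "\<And>x. L' (L x) = x" and M: "\<And>x. L x \<in> M \<longleftrightarrow> x \<in> M"
  shows "diffeo (M \<inter> L -` W) B (\<lambda>x. f (L x))"
proof -
  obtain g where g: "smooth_on (M \<inter> W) f" "smooth_on B g" "f ` (M \<inter> W) = B" "g ` B = M \<inter> W"
      "\<forall>x\<in>M \<inter> W. g (f x) = x" "\<forall>y\<in>B. f (g y) = y"
    using f unfolding diffeo_def by blast
  have img: "L ` (M \<inter> L -` W) = M \<inter> W" "L' ` (M \<inter> W) = M \<inter> L -` W"
    using M inv by (auto simp: image_iff) (metis inv(1) IntI M vimageI)+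
  show ?thesis unfolding diffeo_def
  proof (intro exI[of _ "\<lambda>y. L' (g y)"] conjI)
    show "smooth_on (M \<inter> L -` W) (\<lambda>x. f (L x))"
      by (rule smooth_on_compose[OF smooth_on_bounded_linear[OF L(1)] g(1)]) (simp add: img)
    show "smooth_on B (\<lambda>y. L' (g y))" by (rule smooth_on_linear_compose[OF L(2) g(2)])
    show "(\<lambda>x. f (L x)) ` (M \<inter> L -` W) = B" "(\<lambda>y. L' (g y)) ` B = M \<inter> L -` W"
      using img g by (simp_all add: image_image[symmetric])
  qed (use g M inv in auto)
qed

definition coord_space :: "(C2 \<times> C2) set" where
  "coord_space = {x. snd (snd x) = 0}"

lemma subspace_coord_space: "subspace coord_space"
  by (simp add: subspace_def coord_space_def)

lemma dim_coord_space: "dim coord_space = 6"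
proof -
  let ?f = "\<lambda>x :: C2 \<times> complex. (fst x, (snd x, 0::complex))"
  have "linear ?f" by (rule linearI) auto
  moreover have "inj ?f" by (auto simp: inj_def prod_eq_iff)
  ultimately have "dim (range ?f) = dim (UNIV :: (C2 \<times> complex) set)"
    by (intro dim_image_eq) (simp_all only: span_UNIV)
  moreover have "coord_space = range ?f" by (force simp: coord_space_def image_iff)
  ultimately show ?thesis by (simp only: dim_UNIV) simp
qed

lemma continuous_arg: "continuous_on UNIV (arg1 s)" "continuous_on UNIV (arg2 s)"
  unfolding arg1_def[abs_def] arg2_def[abs_def] half_log_def using inner_self_pos
  by (auto intro!: continuous_intros simp: less_imp_neq[OF inner_self_pos, symmetric])

lemma openin_chart_image: "openin (top_of_set coord_space) (chart_image s)"
proof -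
  have "open {x. \<bar>arg1 s x\<bar> < pi / 2 \<and> \<bar>arg2 s x\<bar> < pi / 2}"
    by (intro open_Collect_conj open_Collect_less continuous_intros continuous_arg)
  moreover have "chart_image s = coord_space \<inter> {x. \<bar>arg1 s x\<bar> < pi / 2 \<and> \<bar>arg2 s x\<bar> < pi / 2}"
    by (auto simp: chart_image_def coord_space_def)
  ultimately show ?thesis by (auto simp: openin_open)
qed

text \<open>Unitary maps preserve the spheres and are complex linear, so the single chart can be
  carried anywhere. The chart differential annihilates the orbit direction for every value of
  \<beta>; therefore the \<beta> computed at \<open>q\<close> can be used at \<open>L q\<close>
  without comparing the forms at the two points.\<close>

lemma ex_chart:
  assumes s: "s * s = 1" and A: "unitary A A'" and B: "unitary B B'"
  defines "L \<equiv> \<lambda>q. (A (fst q), B (snd q))"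
  defines "W \<equiv> L -` chart_domain"
  shows "open W" "diffeo (S3xS3 \<inter> W) (chart_image s) (\<lambda>q. chart s (L q))"
    "\<And>q v. q \<in> S3xS3 \<inter> W \<Longrightarrow> v \<in> tangent_space S3xS3 q \<Longrightarrow>
      differential S3xS3 (\<lambda>q. chart s (L q)) q (complex_structure s q v) =
      map_prod (cm \<i>) (cm \<i>) (differential S3xS3 (\<lambda>q. chart s (L q)) q v)"
proof -
  have lin: "bounded_linear A" "bounded_linear B" "bounded_linear A'" "bounded_linear B'"
    using A B by (auto simp: unitary_def)
  have L: "bounded_linear L" unfolding L_def
    by (intro bounded_linear_Pair bounded_linear_compose[OF lin(1)] bounded_linear_compose[OF lin(2)]
        bounded_linear_fst bounded_linear_snd)
  let ?L' = "\<lambda>q. (A' (fst q), B' (snd q))"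
  have L': "bounded_linear ?L'"
    by (intro bounded_linear_Pair bounded_linear_compose[OF lin(3)] bounded_linear_compose[OF lin(4)]
        bounded_linear_fst bounded_linear_snd)
  show "open W" unfolding W_def
    by (rule open_vimage[OF open_chart_domain]) (rule linear_continuous_on[OF L])
  show "diffeo (S3xS3 \<inter> W) (chart_image s) (\<lambda>q. chart s (L q))" unfolding W_def
    by (rule diffeo_compose_linear[OF diffeo_chart[OF s] L L'])
      (use A B in \<open>auto simp: unitary_def L_def S3xS3_def\<close>)
  fix q v assume q: "q \<in> S3xS3 \<inter> W" and v: "v \<in> tangent_space S3xS3 q"
  have Lq: "L q \<in> chart_domain" using q by (simp add: W_def)
  have "((\<lambda>q. chart s (L q)) has_derivative (\<lambda>v. chart_deriv s (L q) (L v))) (at q)"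
    by (rule has_derivative_compose[OF bounded_linear_imp_has_derivative[OF L] chart_has_derivative[OF Lq]])
  then have D: "((\<lambda>q. chart s (L q)) has_derivative (\<lambda>v. chart_deriv s (L q) (L v))) (at q within S3xS3)"
    by (rule has_derivative_at_withinI)
  have "A (x - y) = A x - A y" "B (x - y) = B x - B y" "A (cm c x) = cm c (A x)" "B (cm c x) = cm c (B x)"
    for c x y
    using A B lin by (simp_all add: unitary_def linear_diff bounded_linear.linear del: split_paired_All)
  then have "L (complex_structure s q v) = (cm \<i> (fst (L v)) - cm (Complex (alpha1 q v) (- s * alpha2 q v)) (fst (L q)),
      cm \<i> (snd (L v)) - cm (s * \<i> * Complex (alpha1 q v) (- s * alpha2 q v)) (snd (L q)))"
    by (simp add: L_def complex_structure_def Let_def)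
  then have "chart_deriv s (L q) (L (complex_structure s q v)) = map_prod (cm \<i>) (cm \<i>) (chart_deriv s (L q) (L v))"
    using chart_deriv_complex_linear[OF s Lq, of "fst (L v)" _ "snd (L v)"]
    by (simp add: map_prod_def case_prod_beta)
  moreover have "complex_structure s q v \<in> tangent_space S3xS3 q" using complex_structure_tangent[OF s _ v] q by simp
  ultimately show "differential S3xS3 (\<lambda>q. chart s (L q)) q (complex_structure s q v) =
      map_prod (cm \<i>) (cm \<i>) (differential S3xS3 (\<lambda>q. chart s (L q)) q v)"
    using differential_eq[OF D] v by simp
qed

lemma integrable_complex_structure:
  assumes s: "s * s = 1"
  shows "integrable_acs 6 S3xS3 (complex_structure s)"
  unfolding integrable_acs_def
proof (intro conjI ballI almost_complex_complex_structure[OF s])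
  fix p assume p: "p \<in> S3xS3"
  then have n: "fst p \<bullet> fst p = 1" "snd p \<bullet> snd p = 1" by (simp_all add: S3xS3_iff)
  let ?L = "\<lambda>q. (rot (fst p) (fst q), rot (snd p) (snd q))"
  let ?W = "?L -` chart_domain" and ?\<zeta> = "\<lambda>q. chart s (?L q)"
  note c = ex_chart[OF s unitary_rot[OF n(1)] unitary_rot[OF n(2)]]
  \<comment> \<open>The rotations take \<open>p\<close> to ((1,0),(1,0)), which lies in the chart
    domain.\<close>
  have p: "p \<in> ?W" by (simp add: chart_domain_def rot_self n)
  have I: "linear_on_subspace coord_space (map_prod (cm \<i>) (cm \<i>))"
    "map_prod (cm \<i>) (cm \<i>) ` coord_space \<subseteq> coord_space"
    "\<And>x. map_prod (cm \<i>) (cm \<i>) (map_prod (cm \<i>) (cm \<i>) x) = - x"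
    by (simp add: linear_on_subspace_def C2_simps prod_eq_iff, auto simp: coord_space_def cm_def)
  show "\<exists>W (V :: (C2 \<times> C2) set) U I \<zeta>. open W \<and> p \<in> W \<and> subspace V \<and> dim V = 6 \<and>
        linear_on_subspace V I \<and> I ` V \<subseteq> V \<and> (\<forall>x\<in>V. I (I x) = - x) \<and>
        openin (top_of_set V) U \<and> diffeo (S3xS3 \<inter> W) U \<zeta> \<and>
        (\<forall>q\<in>S3xS3 \<inter> W. \<forall>v\<in>tangent_space S3xS3 q.
           differential S3xS3 \<zeta> q (complex_structure s q v) = I (differential S3xS3 \<zeta> q v))"
    by (rule exI[of _ ?W], rule exI[of _ coord_space], rule exI[of _ "chart_image s"],
        rule exI[of _ "map_prod (cm \<i>) (cm \<i>)"], rule exI[of _ ?\<zeta>], intro conjI ballI)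
      (rule p I c subspace_coord_space dim_coord_space openin_chart_image; assumption)+
qed

text \<open>Holomorphic charts are in particular smooth charts, so integrability already contains
  the manifold property.\<close>

lemma manifold_S3xS3: "manifold 6 S3xS3"
  using integrable_complex_structure[of 1] unfolding integrable_acs_def manifold_def by simp metis

lemma hermitian_bicontact_S3xS3:
  "hermitian_bicontact_11 6 S3xS3 1 1 alpha1 alpha2 reeb1 reeb2 phi (\<lambda>p. (\<bullet>))"
  unfolding hermitian_bicontact_11_def J_structure_eq T_structure_eq
  by (intro conjI metric_contact_pair_S3xS3 manifold_S3xS3 integrable_complex_structure decomposable_S3xS3) auto

section \<open>The preimage of the diagonal\<close>

definition detC :: "C2 \<Rightarrow> C2 \<Rightarrow> complex" where
  "detC x y = fst x * snd y - snd x * fst y"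

text \<open>For nonzero z and w the determinant vanishes exactly when both span the same complex
  line, that is, when their Hopf images agree.\<close>

definition diagonal_preimage :: "(C2 \<times> C2) set" where
  "diagonal_preimage = {p \<in> S3xS3. detC (fst p) (snd p) = 0}"

lemma detC_cm: "detC (cm c x) y = c * detC x y" "detC x (cm c y) = c * detC x y" "detC x x = 0"
  by (simp_all add: detC_def cm_def algebra_simps)

lemma detC_diff: "detC (x - y) z = detC x z - detC y z" "detC x (y - z) = detC x y - detC x z"
  by (simp_all add: detC_def algebra_simps)

lemma parallel:
  assumes z: "z \<bullet> z = (1::real)" and d: "detC z w = 0"
  obtains c where "w = cm c z"
proof
  have "fst z * snd w = snd z * fst w" using d by (simp add: detC_def)
  then have "cm (cnj (fst z) * fst w + cnj (snd z) * snd w) z =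
      cm (fst z * cnj (fst z) + snd z * cnj (snd z)) w"
    by (simp add: cm_def algebra_simps)
  then show "w = cm (cnj (fst z) * fst w + cnj (snd z) * snd w) z"
    by (simp add: unit_cnj[OF z] cm_1)
qed

lemma inner_cm_cm: "cm c x \<bullet> cm d x = Re (c * cnj d) * (x \<bullet> x)"
  by (simp add: cm_def inner_prod_def inner_complex_def algebra_simps)

lemma inner_cm_same: "cm c x \<bullet> cm c y = norm c ^ 2 * (x \<bullet> y)"
  unfolding cmod_power2
  by (simp add: cm_def inner_prod_def inner_complex_def algebra_simps power2_eq_square)

lemma diagonal_preimage_parallel:
  assumes "p \<in> diagonal_preimage"
  obtains c where "norm c = 1" "snd p = cm c (fst p)"
proof -
  have n: "norm (fst p) = 1" "norm (snd p) = 1" "detC (fst p) (snd p) = 0"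
    using assms by (auto simp: diagonal_preimage_def S3xS3_iff norm_eq_1)
  then obtain c where c: "snd p = cm c (fst p)" using parallel by (metis norm_eq_1)
  then have "norm c = 1" using n norm_cm[of c "fst p"] by simp
  then show ?thesis using c that by blast
qed

text \<open>One direction differentiates the equations. The other needs a curve inside the set;
  since its points have the form (z, cz), a curve on the sphere and a curve of phases are
  combined.\<close>

lemma tangent_diagonal_preimage:
  assumes p: "p \<in> diagonal_preimage"
  shows "v \<in> tangent_space diagonal_preimage p \<longleftrightarrow>
    v \<in> tangent_space S3xS3 p \<and> detC (fst v) (snd p) + detC (fst p) (snd v) = 0"
proof
  have pS: "p \<in> S3xS3" using p by (simp add: diagonal_preimage_def)
  {
    assume v: "v \<in> tangent_space diagonal_preimage p"
    then have "v \<in> tangent_space S3xS3 p"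
      using tangent_space_subset[of diagonal_preimage S3xS3 p] by (auto simp: diagonal_preimage_def)
    moreover have "detC (fst p) (snd v) + detC (fst v) (snd p) = 0"
    proof (rule tangent_constant[OF _ p _ v])
      show "((\<lambda>q. detC (fst q) (snd q)) has_derivative
          (\<lambda>v. detC (fst p) (snd v) + detC (fst v) (snd p))) (at p within diagonal_preimage)"
        unfolding detC_def by (auto intro!: derivative_eq_intros simp: algebra_simps)
    qed (simp add: diagonal_preimage_def)
    ultimately show "v \<in> tangent_space S3xS3 p \<and> detC (fst v) (snd p) + detC (fst p) (snd v) = 0"
      by (simp add: add.commute)
  next
    assume *: "v \<in> tangent_space S3xS3 p \<and> detC (fst v) (snd p) + detC (fst p) (snd v) = 0"
    obtain z w X Y where eqs: "p = (z, w)" "v = (X, Y)" by (metis surj_pair)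
    have n: "z \<bullet> z = 1" "w \<bullet> w = 1" using pS by (simp_all add: eqs S3xS3_iff)
    have t: "z \<bullet> X = 0" "w \<bullet> Y = 0" and d: "detC X w + detC z Y = 0"
      using * tangent_S3xS3[OF pS, of v] by (simp_all add: eqs)
    obtain c where c: "norm c = 1" "w = cm c z"
      using diagonal_preimage_parallel[OF p] by (auto simp: eqs)
    \<comment> \<open>With w = cz, alternation turns the linearised equation into the vanishing of
      one determinant, so Y and cX differ by a complex multiple of z.\<close>
    have "detC z (Y - cm c X) = detC X w + detC z Y"
      by (simp add: c detC_def cm_def algebra_simps)
    then obtain \<nu> where \<nu>: "Y - cm c X = cm \<nu> z" using parallel[OF n(1)] d by metis
    then have Y: "Y = cm c X + cm \<nu> z" by (simp add: algebra_simps)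
    \<comment> \<open>Tangency of Y to the second sphere makes \<nu>/c imaginary, say i \<mu>. Hence
      the curve \<open>\<rho>\<close>, which starts at c with velocity \<nu>, can be chosen on the
      unit circle.\<close>
    have "0 = cm c z \<bullet> cm c X + cm c z \<bullet> cm \<nu> z" using t(2) by (simp add: Y c(2) inner_simps)
    also have "\<dots> = Re (\<nu> * cnj c)"
      by (simp add: inner_cm_same inner_cm_cm n t mult.commute)
    finally have re: "Re (\<nu> * cnj c) = 0" ..
    define \<mu> where "\<mu> = Im (\<nu> * cnj c)"
    have "\<i> * of_real \<mu> = \<nu> * cnj c" using re by (simp add: \<mu>_def complex_eq_iff)
    then have "c * (\<i> * of_real \<mu>) = \<nu> * (c * cnj c)" by simp
    also have "c * cnj c = 1" using c(1) by (simp add: complex_norm_square[symmetric])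
    finally have \<mu>: "c * (\<i> * of_real \<mu>) = \<nu>" by simp
    define \<rho> where "\<rho> t = c * exp (t *\<^sub>R (\<i> * of_real \<mu>))" for t :: real
    let ?c = "sphere_curve z X"
    let ?\<gamma> = "\<lambda>t. (?c t, cm (\<rho> t) (?c t))"
    note sc = sphere_curve[OF n(1) t(1)]
    have "(\<rho> has_vector_derivative \<nu>) (at 0)"
      using has_vector_derivative_mult_right[OF exp_scaleR_has_vector_derivative_right, of c "\<i> * of_real \<mu>" 0 UNIV]
      by (simp add: \<rho>_def[abs_def] \<mu>)
    from bounded_bilinear.has_vector_derivative[OF bounded_bilinear_cm this sc(3)]
    have "((\<lambda>t. cm (\<rho> t) (?c t)) has_vector_derivative Y) (at 0)"
      by (simp add: Y sc(1) \<rho>_def)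
    then have "(?\<gamma> has_vector_derivative v) (at 0)"
      unfolding eqs by (intro has_vector_derivative_Pair sc)
    moreover have "norm (\<rho> t) = 1" for t by (simp add: \<rho>_def norm_mult c)
    then have "?\<gamma> ` {-1<..<1} \<subseteq> diagonal_preimage"
      by (auto simp: diagonal_preimage_def S3xS3_iff detC_cm inner_cm_same sc)
    moreover have "?\<gamma> 0 = p" by (simp add: sc eqs c \<rho>_def)
    moreover have "smooth_on {-1<..<1} ?\<gamma>" unfolding \<rho>_def
      by (intro smooth_intros smooth_on_cm smooth_on_sphere_curve)
    ultimately show "v \<in> tangent_space diagonal_preimage p"
      unfolding tangent_space_def by (intro CollectI exI[of _ ?\<gamma>] exI[of _ 1]) auto
  }
qed

text \<open>In the chart the diagonal is the linear condition that both quotients agree, so charts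
  of the submanifold are restrictions of charts of the whole.\<close>

definition diagonal_coord_space :: "(C2 \<times> C2) set" where
  "diagonal_coord_space = {x \<in> coord_space. fst (fst x) = snd (fst x)}"

lemma subspace_diagonal_coord_space: "subspace diagonal_coord_space"
  by (simp add: subspace_def diagonal_coord_space_def coord_space_def)

lemma dim_diagonal_coord_space: "dim diagonal_coord_space = 4"
proof -
  let ?f = "\<lambda>x :: C2. ((fst x, fst x), (snd x, 0::complex))"
  have "linear ?f" by (rule linearI) auto
  moreover have "inj ?f" by (auto simp: inj_def prod_eq_iff)
  ultimately have "dim (range ?f) = dim (UNIV :: C2 set)"
    by (intro dim_image_eq) (simp_all only: span_UNIV)
  moreover have "diagonal_coord_space = range ?f"
    by (force simp: diagonal_coord_space_def coord_space_def image_iff)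
  ultimately show ?thesis by (simp only: dim_UNIV) simp
qed

lemma detC_rot: "z \<bullet> z = (1::real) \<Longrightarrow> detC (rot z x) (rot z y) = detC x y"
proof -
  assume z: "z \<bullet> z = (1::real)"
  have "detC (rot z x) (rot z y) = (fst z * cnj (fst z) + snd z * cnj (snd z)) * detC x y"
    by (simp add: detC_def rot_def algebra_simps)
  then show ?thesis by (simp add: unit_cnj[OF z])
qed

lemma chart_diagonal_iff:
  assumes "q \<in> chart_domain"
  shows "chart s q \<in> diagonal_coord_space \<longleftrightarrow> detC (fst q) (snd q) = 0"
proof -
  have "fst (fst q) \<noteq> 0" "fst (snd q) \<noteq> 0" using assms by (auto simp: chart_domain_def)
  then show ?thesis
    by (auto simp: chart_def diagonal_coord_space_def coord_space_def detC_def field_simps)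
qed

lemma manifold_diagonal_preimage: "manifold 4 diagonal_preimage"
  unfolding manifold_def
proof
  fix p assume p: "p \<in> diagonal_preimage"
  then have n: "fst p \<bullet> fst p = 1" by (simp add: diagonal_preimage_def S3xS3_iff)
  obtain c where c: "norm c = 1" "snd p = cm c (fst p)" using diagonal_preimage_parallel[OF p] .
  then have c': "norm (inverse c) = 1" "c \<noteq> 0" by (auto simp: norm_inverse)
  \<comment> \<open>Rotating both factors in the same way and dividing the second by the phase c
    preserves the vanishing of the determinant and takes \<open>p\<close> to ((1,0),(1,0)).\<close>
  let ?L = "\<lambda>q. (rot (fst p) (fst q), cm (inverse c) (rot (fst p) (snd q)))"
  let ?W = "?L -` chart_domain" and ?\<zeta> = "\<lambda>q. chart 1 (?L q)"
  note u = unitary_rot[OF n]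
  note ch = ex_chart[OF _ u unitary_cm[OF u c'(1)], of 1, simplified]
  have "?L p = ((1, 0), (1, 0))"
    using u by (simp add: unitary_def c(2) rot_self[OF n] cm_cm c'(2) cm_1 del: split_paired_All)
  then have "p \<in> ?W" by (simp add: chart_domain_def)
  have sub: "diagonal_preimage \<subseteq> S3xS3" by (auto simp: diagonal_preimage_def)
  have iff: "q \<in> diagonal_preimage \<longleftrightarrow> ?\<zeta> q \<in> diagonal_coord_space" if "q \<in> S3xS3 \<inter> ?W" for q
    using that c'(2) chart_diagonal_iff[of "?L q" 1]
    by (simp add: diagonal_preimage_def detC_cm detC_rot[OF n])
  have im: "?\<zeta> ` (S3xS3 \<inter> ?W) = chart_image 1" using ch(2) unfolding diffeo_def by blast
  have "?\<zeta> ` (diagonal_preimage \<inter> ?W) = chart_image 1 \<inter> diagonal_coord_space"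
  proof
    show "?\<zeta> ` (diagonal_preimage \<inter> ?W) \<subseteq> chart_image 1 \<inter> diagonal_coord_space"
    proof
      fix y assume "y \<in> ?\<zeta> ` (diagonal_preimage \<inter> ?W)"
      then obtain q where q: "q \<in> diagonal_preimage" "q \<in> S3xS3 \<inter> ?W" "y = ?\<zeta> q"
        using sub by blast
      then show "y \<in> chart_image 1 \<inter> diagonal_coord_space" using im iff[OF q(2)] by blast
    qed
    show "chart_image 1 \<inter> diagonal_coord_space \<subseteq> ?\<zeta> ` (diagonal_preimage \<inter> ?W)"
    proof
      fix y assume y: "y \<in> chart_image 1 \<inter> diagonal_coord_space"
      then obtain q where "q \<in> S3xS3 \<inter> ?W" "y = ?\<zeta> q" using im by blast
      then show "y \<in> ?\<zeta> ` (diagonal_preimage \<inter> ?W)" using iff y by blast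
    qed
  qed
  then have "diffeo (diagonal_preimage \<inter> ?W) (chart_image 1 \<inter> diagonal_coord_space) ?\<zeta>"
    using diffeo_subset[OF ch(2) Int_mono[OF sub order_refl]] by (simp only:)
  moreover have "openin (top_of_set diagonal_coord_space) (chart_image 1 \<inter> diagonal_coord_space)"
    using openin_chart_image[of 1] by (force simp: openin_open diagonal_coord_space_def)
  ultimately show "\<exists>W (V :: (C2 \<times> C2) set) U \<zeta>. open W \<and> p \<in> W \<and> subspace V \<and> dim V = 4 \<and>
      openin (top_of_set V) U \<and> diffeo (diagonal_preimage \<inter> W) U \<zeta>"
    by (rule_tac x = ?W in exI, rule_tac x = diagonal_coord_space in exI,
        rule_tac x = "chart_image 1 \<inter> diagonal_coord_space" in exI, rule_tac x = ?\<zeta> in exI)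
      (simp only: ch(1) \<open>p \<in> ?W\<close> subspace_diagonal_coord_space dim_diagonal_coord_space simp_thms)
qed

text \<open>Presents the submanifold as a continuous image of a circle times a 3-sphere, which gives
  compactness and connectedness.\<close>

lemma diagonal_preimage_eq:
  "diagonal_preimage = (\<lambda>x. (snd x, cm (fst x) (snd x))) ` (sphere 0 1 \<times> sphere 0 1)"
proof
  show "diagonal_preimage \<subseteq> (\<lambda>x. (snd x, cm (fst x) (snd x))) ` (sphere 0 1 \<times> sphere 0 1)"
  proof
    fix p assume p: "p \<in> diagonal_preimage"
    then obtain c where c: "norm c = 1" "snd p = cm c (fst p)" using diagonal_preimage_parallel by blast
    have "norm (fst p) = 1" using p by (simp add: diagonal_preimage_def S3xS3_iff norm_eq_1)
    then show "p \<in> (\<lambda>x. (snd x, cm (fst x) (snd x))) ` (sphere 0 1 \<times> sphere 0 1)"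
      using c by (intro image_eqI[of _ _ "(c, fst p)"]) (simp_all add: prod_eq_iff)
  qed
qed (auto simp: diagonal_preimage_def S3xS3_def norm_cm detC_cm)

lemma
  shows compact_diagonal_preimage: "compact diagonal_preimage"
    and connected_diagonal_preimage: "connected diagonal_preimage"
proof -
  have "continuous_on S (\<lambda>x. (snd x, cm (fst x) (snd x)))" for S
    by (intro continuous_on_Pair bounded_bilinear.continuous_on[OF bounded_bilinear_cm] continuous_intros)
  then show "compact diagonal_preimage" "connected diagonal_preimage"
    unfolding diagonal_preimage_eq
    by (auto intro!: compact_continuous_image connected_continuous_image compact_Times connected_Times
        connected_sphere)
qed

text \<open>The linearised determinant equation is complex linear in the vector, and the correction
  along the orbit adds only multiples of the determinant of z and w, which is 0 on the
  submanifold.\<close>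

lemma complex_submanifold_diagonal_preimage: "complex_submanifold 4 diagonal_preimage S3xS3 (complex_structure 1)"
  unfolding complex_submanifold_def
proof (intro conjI manifold_diagonal_preimage ballI subsetI)
  fix p x assume p: "p \<in> diagonal_preimage" and "x \<in> complex_structure 1 p ` tangent_space diagonal_preimage p"
  then obtain v where x: "x = complex_structure 1 p v" and v: "v \<in> tangent_space S3xS3 p"
    and d: "detC (fst v) (snd p) + detC (fst p) (snd v) = 0"
    by (auto simp: tangent_diagonal_preimage)
  have pS: "p \<in> S3xS3" "detC (fst p) (snd p) = 0" using p by (auto simp: diagonal_preimage_def)
  have "detC (fst x) (snd p) + detC (fst p) (snd x) = \<i> * (detC (fst v) (snd p) + detC (fst p) (snd v))"
    using pS(2) by (simp add: x complex_structure_def Let_def detC_diff detC_cm distrib_left)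
  then show "x \<in> tangent_space diagonal_preimage p"
    using complex_structure_tangent[OF _ pS(1) v, of 1] d by (simp add: tangent_diagonal_preimage[OF p] x)
qed (auto simp: diagonal_preimage_def)

text \<open>One point and one pair of vectors detect both derivatives, which settles both possible
  types of a contact pair together. Explicit vector fields tangent to the submanifold everywhere are
  constructed because \<open>ext_deriv\<close> is defined through such fields.\<close>

lemma ext_deriv_diagonal_preimage:
  obtains p u v where "p \<in> diagonal_preimage"
    "u \<in> tangent_space diagonal_preimage p" "v \<in> tangent_space diagonal_preimage p"
    "wedge_power 2 (as_2form (ext_deriv diagonal_preimage alpha1 p)) 1 (\<lambda>i. if i = 0 then u else v) \<noteq> 0"
    "wedge_power 2 (as_2form (ext_deriv diagonal_preimage alpha2 p)) 1 (\<lambda>i. if i = 0 then u else v) \<noteq> 0"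
proof -
  \<comment> \<open>\<open>A\<close> and \<open>B\<close> generate flows of the diagonal \<open>SU(2)\<close>-action, which preserves \<open>N\<close>.\<close>
  define A where "A x = (- snd x, fst x)" for x :: C2
  define B where "B x = cm \<i> (snd x, fst x)" for x :: C2
  let ?N = diagonal_preimage
  let ?X = "\<lambda>q. (A (fst q), A (snd q))" and ?Y = "\<lambda>q. (B (fst q), B (snd q))"
  have lin: "bounded_linear A" "bounded_linear B" unfolding A_def[abs_def] B_def[abs_def]
    by (intro bounded_linear_Pair bounded_linear_minus bounded_linear_fst bounded_linear_snd
        bounded_linear_compose[OF bounded_linear_cm])+
  have "x \<bullet> A x = 0" "x \<bullet> B x = 0" "detC (A x) y + detC x (A y) = 0" "detC (B x) y + detC x (B y) = 0" for x y
    by (simp_all add: A_def B_def cm_def detC_def inner_prod_def inner_complex_def algebra_simps)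
  then have "?X q \<in> tangent_space ?N q" "?Y q \<in> tangent_space ?N q" if q: "q \<in> ?N" for q
    using q tangent_S3xS3[of q] unfolding tangent_diagonal_preimage[OF q]
    by (simp_all add: diagonal_preimage_def)
  moreover have "smooth_on ?N ?X" "smooth_on ?N ?Y"
    by (intro smooth_intros smooth_on_linear_compose[OF lin(1)] smooth_on_linear_compose[OF lin(2)])+
  ultimately have vf: "vector_field ?N ?X" "vector_field ?N ?Y" unfolding vector_field_def by blast+
  \<comment> \<open>At (1,0) the fields \<open>A\<close> and \<open>B\<close> take the values (0,1)
    and (0,i), a basis of the contact plane, so both derivatives are nonzero on the resulting
    pair.\<close>
  define p :: "C2 \<times> C2" where "p = ((1, 0), (1, 0))"
  have p: "p \<in> ?N" by (simp add: p_def diagonal_preimage_def S3xS3_iff detC_def)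
  show ?thesis
  proof (rule that[OF p, of "?X p" "?Y p"])
    show "?X p \<in> tangent_space ?N p" "?Y p \<in> tangent_space ?N p"
      using vf p by (auto simp: vector_field_def)
    show "wedge_power 2 (as_2form (ext_deriv ?N alpha1 p)) 1 (\<lambda>i. if i = 0 then ?X p else ?Y p) \<noteq> 0"
      "wedge_power 2 (as_2form (ext_deriv ?N alpha2 p)) 1 (\<lambda>i. if i = 0 then ?X p else ?Y p) \<noteq> 0"
      unfolding wedge_power_2_one
      using ext_deriv_alpha[OF p vf] ext_deriv_alpha[OF p vf(2,1)]
      by (simp_all add: p_def A_def B_def cm_def inner_prod_def inner_complex_def)
  qed
qed

text \<open>Dimension 4 forces h + k = 1. If h = 0, the condition on the power h + 1 says that the
  derivative of \<open>alpha1\<close> vanishes; if k = 0, it says so for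
  \<open>alpha2\<close>.\<close>

lemma not_contact_pair_diagonal_preimage: "\<not> contact_pair 4 diagonal_preimage h k alpha1 alpha2"
proof
  assume cp: "contact_pair 4 diagonal_preimage h k alpha1 alpha2"
  then have "4 = 2 * h + 2 * k + 2" unfolding contact_pair_def by blast
  then have hk: "h = 0 \<or> k = 0" by arith
  obtain p u v where p: "p \<in> diagonal_preimage"
    and t: "u \<in> tangent_space diagonal_preimage p" "v \<in> tangent_space diagonal_preimage p"
    and w: "wedge_power 2 (as_2form (ext_deriv diagonal_preimage alpha1 p)) 1 (\<lambda>i. if i = 0 then u else v) \<noteq> 0"
      "wedge_power 2 (as_2form (ext_deriv diagonal_preimage alpha2 p)) 1 (\<lambda>i. if i = 0 then u else v) \<noteq> 0"
    using ext_deriv_diagonal_preimage .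
  have "\<forall>v. (\<forall>i<2 * (h + 1). v i \<in> tangent_space diagonal_preimage p) \<longrightarrow>
        wedge_power 2 (as_2form (ext_deriv diagonal_preimage alpha1 p)) (h + 1) v = 0"
    "\<forall>v. (\<forall>i<2 * (k + 1). v i \<in> tangent_space diagonal_preimage p) \<longrightarrow>
        wedge_power 2 (as_2form (ext_deriv diagonal_preimage alpha2 p)) (k + 1) v = 0"
    using cp p unfolding contact_pair_def by blast+
  from this[THEN spec, of "\<lambda>i. if i = 0 then u else v"] show False
    using hk t w by (auto simp del: wedge_power.simps One_nat_def)
qed

text \<open>The demand \<open>n > 0\<close> rules out single points, which are complex submanifolds
  and fail to carry a contact pair merely because its dimension is at least 2.\<close>

theorem proposition18:
  shows "\<exists>(M :: ((complex \<times> complex) \<times> (complex \<times> complex)) set) d h k \<alpha>1 \<alpha>2 Z1 Z2 \<phi> g N n.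
    hermitian_bicontact_11 d M h k \<alpha>1 \<alpha>2 Z1 Z2 \<phi> g \<and>
    complex_submanifold n N M (J_structure \<alpha>1 \<alpha>2 Z1 Z2 \<phi>) \<and>
    compact N \<and> connected N \<and> N \<noteq> {} \<and> n > 0 \<and>
    \<not> (\<exists>h' k'. contact_pair n N h' k' \<alpha>1 \<alpha>2)"
proof (intro exI conjI)
  show "hermitian_bicontact_11 6 S3xS3 1 1 alpha1 alpha2 reeb1 reeb2 phi (\<lambda>p. (\<bullet>))"
    by (rule hermitian_bicontact_S3xS3)
  show "complex_submanifold 4 diagonal_preimage S3xS3 (J_structure alpha1 alpha2 reeb1 reeb2 phi)"
    unfolding J_structure_eq by (rule complex_submanifold_diagonal_preimage)
  show "diagonal_preimage \<noteq> {}" using ext_deriv_diagonal_preimage by blast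
qed (auto simp: compact_diagonal_preimage connected_diagonal_preimage not_contact_pair_diagonal_preimage)

end
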